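(* Let $d=2$, and fix $\lambda>0$ and $r>0$. Let $g=(g(s))_{s\ge 0}$ be any continuous process in $\mathbb{R}^2$ with $g(0)=0$ that is independent of the mobile nodes (their initial positions and motions). Then, as $t\to\infty$, $$\mathbf{P}[T_{\mathrm{det}}>t]\le \exp\left(-2\pi\lambda\,\frac{t}{\log t}\,(1+o(1))\right).$$ In addition, if $g$ is a standard Brownian motion independent of the nodes, then this bound is tight, i.e., as $t\to\infty$, $$\mathbf{P}[T_{\mathrm{det}}>t]= \exp\left(-2\pi\lambda\,\frac{t}{\log t}\,(1+o(1))\right).$$
   Context: Mobile geometric graph model: $\Pi_0=\{X_i\}_i$ is a Poisson point process on $\mathbb{R}^d$ of intensity $\lambda$; each node $X_i$ moves as $X_i+\zeta_i(s)$, $s\ge 0$, where the $\zeta_i$ are independent standard $d$-dimensional Brownian motions started at $0$, independent of $\Pi_0$. $B(x,r)$ denotes the (closed) ball of radius $r$ centered at $x$. A target particle has position $g(s)$ at time $s$, starting at the origin. The detection time is $$T_{\mathrm{det}}=\inf\Big\{t\ge 0:\ g(t)\in\bigcup_i B(X_i+\zeta_i(t),r)\Big\}.$$ *)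

theory Defs
  imports "HOL-Probability.Probability" "HOL-Library.Landau_Symbols"
begin

text \<open>Processes are indexed by real times, of which only those in \<open>{0..}\<close> are used. The sample
  path is restricted accordingly, so that it is a point of the product space \<open>path_space\<close>.\<close>

definition sample_path :: "(real \<Rightarrow> 'w \<Rightarrow> 'a) \<Rightarrow> 'w \<Rightarrow> (real \<Rightarrow> 'a)" where
  "sample_path B \<omega> = (\<lambda>s\<in>{0..}. B s \<omega>)"

definition path_space :: "(real \<Rightarrow> 'a::euclidean_space) measure" where
  "path_space = (\<Pi>\<^sub>M s\<in>{0..}. borel)"

definition continuous_process :: "'w measure \<Rightarrow> (real \<Rightarrow> 'w \<Rightarrow> 'a::euclidean_space) \<Rightarrow> bool" where
  "continuous_process M B \<longleftrightarrow>
     (\<forall>s\<ge>0. B s \<in> borel_measurable M) \<and>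
     (\<forall>\<omega>\<in>space M. continuous_on {0..} (\<lambda>s. B s \<omega>))"

text \<open>The product of one-dimensional densities is the density of the centred Gaussian law with
  covariance matrix \<open>(t - s)\<close> times the identity.\<close>

definition standard_brownian_motion ::
    "'w measure \<Rightarrow> (real \<Rightarrow> 'w \<Rightarrow> 'a::euclidean_space) \<Rightarrow> bool" where
  "standard_brownian_motion M B \<longleftrightarrow>
     continuous_process M B \<and>
     (\<forall>\<omega>\<in>space M. B 0 \<omega> = 0) \<and>
     (\<forall>n (t :: nat \<Rightarrow> real). 0 \<le> t 0 \<and> (\<forall>k<n. t k \<le> t (Suc k)) \<longrightarrow>
        prob_space.indep_vars M (\<lambda>_. borel) (\<lambda>k \<omega>. B (t (Suc k)) \<omega> - B (t k) \<omega>) {..<n}) \<and>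
     (\<forall>s t. 0 \<le> s \<and> s < t \<longrightarrow>
        distributed M lborel (\<lambda>\<omega>. B t \<omega> - B s \<omega>)
          (\<lambda>x. ennreal (\<Prod>b\<in>Basis. normal_density 0 (sqrt (t - s)) (x \<bullet> b))))"

text \<open>Unlike \<open>prob_space.indep_var\<close>, this allows the two variables to have different types.\<close>

definition independent_variables ::
    "'w measure \<Rightarrow> 'b measure \<Rightarrow> ('w \<Rightarrow> 'b) \<Rightarrow> 'c measure \<Rightarrow> ('w \<Rightarrow> 'c) \<Rightarrow> bool" where
  "independent_variables M N\<^sub>1 Y\<^sub>1 N\<^sub>2 Y\<^sub>2 \<longleftrightarrow>
     Y\<^sub>1 \<in> measurable M N\<^sub>1 \<and> Y\<^sub>2 \<in> measurable M N\<^sub>2 \<and>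
     prob_space.indep_set M
       {Y\<^sub>1 -` A \<inter> space M | A. A \<in> sets N\<^sub>1} {Y\<^sub>2 -` A \<inter> space M | A. A \<in> sets N\<^sub>2}"

text \<open>A point process is given by an enumeration \<open>X\<close> of its points; points are counted with
  multiplicity.\<close>

definition point_count :: "(nat \<Rightarrow> 'w \<Rightarrow> 'a) \<Rightarrow> 'a set \<Rightarrow> 'w \<Rightarrow> nat" where
  "point_count X A \<omega> = card {i. X i \<omega> \<in> A}"

text \<open>Finiteness is required separately because \<open>card\<close> vanishes on infinite sets. The Poisson law
  is written out because \<open>poisson_pmf\<close> does not cover rate \<open>0\<close>, i.e. Lebesgue-null \<open>A\<close>.\<close>

definition poisson_point_process ::
    "'w measure \<Rightarrow> real \<Rightarrow> (nat \<Rightarrow> 'w \<Rightarrow> 'a::euclidean_space) \<Rightarrow> bool" where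
  "poisson_point_process M lam X \<longleftrightarrow>
     (\<forall>i. X i \<in> borel_measurable M) \<and>
     (\<forall>A\<in>sets borel. emeasure lborel A < \<infinity> \<longrightarrow>
        (AE \<omega> in M. finite {i. X i \<omega> \<in> A}) \<and>
        (\<forall>k. measure M {\<omega>\<in>space M. point_count X A \<omega> = k} =
           exp (- (lam * measure lborel A)) * (lam * measure lborel A) ^ k / fact k)) \<and>
     (\<forall>F. finite F \<and> disjoint F \<and> (\<forall>A\<in>F. A \<in> sets borel \<and> emeasure lborel A < \<infinity>) \<longrightarrow>
        prob_space.indep_vars M (\<lambda>_. count_space UNIV) (point_count X) F)"

text \<open>Node \<open>i\<close> is at \<open>X i + \<zeta> i s\<close> at time \<open>s\<close>.\<close>

definition mobile_nodes ::
    "'w measure \<Rightarrow> real \<Rightarrow> (nat \<Rightarrow> 'w \<Rightarrow> 'a::euclidean_space) \<Rightarrow> (nat \<Rightarrow> real \<Rightarrow> 'w \<Rightarrow> 'a) \<Rightarrow> bool" where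
  "mobile_nodes M lam X \<zeta> \<longleftrightarrow>
     poisson_point_process M lam X \<and>
     (\<forall>i. standard_brownian_motion M (\<zeta> i)) \<and>
     prob_space.indep_vars M (\<lambda>_. path_space) (\<lambda>i. sample_path (\<zeta> i)) UNIV \<and>
     independent_variables M
       (\<Pi>\<^sub>M i\<in>UNIV. borel) (\<lambda>\<omega> i. X i \<omega>)
       (\<Pi>\<^sub>M i\<in>UNIV. path_space) (\<lambda>\<omega> i. sample_path (\<zeta> i) \<omega>)"

definition independent_of_nodes ::
    "'w measure \<Rightarrow> (nat \<Rightarrow> 'w \<Rightarrow> 'a::euclidean_space) \<Rightarrow> (nat \<Rightarrow> real \<Rightarrow> 'w \<Rightarrow> 'a) \<Rightarrow>
     (real \<Rightarrow> 'w \<Rightarrow> 'a) \<Rightarrow> bool" where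
  "independent_of_nodes M X \<zeta> g \<longleftrightarrow>
     independent_variables M
       path_space (sample_path g)
       ((\<Pi>\<^sub>M i\<in>UNIV. borel) \<Otimes>\<^sub>M (\<Pi>\<^sub>M i\<in>UNIV. path_space))
       (\<lambda>\<omega>. (\<lambda>i. X i \<omega>, \<lambda>i. sample_path (\<zeta> i) \<omega>))"

text \<open>The value is \<open>\<infinity>\<close>, the infimum of the empty set, if the target is never detected.\<close>

definition detection_time ::
    "(nat \<Rightarrow> 'w \<Rightarrow> 'a::euclidean_space) \<Rightarrow> (nat \<Rightarrow> real \<Rightarrow> 'w \<Rightarrow> 'a) \<Rightarrow> real \<Rightarrow>
     (real \<Rightarrow> 'w \<Rightarrow> 'a) \<Rightarrow> 'w \<Rightarrow> ereal" where
  "detection_time X \<zeta> r g \<omega> =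
     Inf (ereal ` {t. 0 \<le> t \<and> g t \<omega> \<in> (\<Union>i. cball (X i \<omega> + \<zeta> i t \<omega>) r)})"

end

theory Submission
  imports Defs "HOL-Real_Asymp.Real_Asymp"
begin

text \<open>Given the target path, the nodes that hit the target are a thinned Poisson process, so the
  target survives with probability \<open>exp (- lam * v)\<close>, where \<open>v\<close> is the expected volume of the sausage
  swept out by one node relative to the target. All estimates are made on time grids, where the first
  entrance can be handled by induction instead of the strong Markov property.

  Upper bound: only integer times are watched. By translation invariance the occupation number of the
  detection discs, integrated over all starting points, is exactly \<open>pi * r\<^sup>2\<close> per time step, whatever
  the target does, while a node that hits the target once makes at most \<open>1 + r\<^sup>2 / 2 * (1 + ln t)\<close> visits
  on average, because the Gaussian density at time \<open>s\<close> is at most \<open>1 / (2 * pi * s)\<close>. Hence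
  \<open>v\<close> is at least \<open>2 * pi * t / ln t\<close> to leading order.

  Lower bound for a Brownian target: it stays in a box of width of order \<open>ln t\<close> with probability
  \<open>exp (- O (t / (ln t)\<^sup>2))\<close>, which is negligible against \<open>exp (- t / ln t)\<close>. Then it suffices that
  no node enters a disc of radius of order \<open>ln t\<close> around the origin, and the matching upper bound on the
  volume of that sausage comes from the same occupation identity, now with a lower bound for the number of
  visits during a further time \<open>t / ln t\<close>. Both bounds are uniform in the grid, and the dyadic grids
  exhaust the continuous paths.\<close>

section \<open>Gaussian laws\<close>

text \<open>The constant \<open>2 * pi\<close> does not see the radius: total occupation is area
  times duration, and in the plane one entrance produces occupation of about area times
  \<open>ln t / (2 * pi)\<close>, so the area cancels in the quotient. This is why the lower bound
  may inflate the discs to a radius growing with \<open>t\<close>: at leading order nothing is lost,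
  as the radius survives only inside a logarithm.

  Two obstacles shape the formal argument. The nodes come in an arbitrary enumeration, so the law of
  the first \<open>m\<close> points is not determined; only the limit of the products over
  \<open>i < m\<close> can be computed. And paths live in a product space, where an event can be
  measured only through countably many times. Conditioning on the target therefore becomes Fubini
  for predicates that look at grid times, and continuity is used only to pass from grids to
  intervals.\<close>

definition gauss_law :: "real \<Rightarrow> 'a::euclidean_space measure" where
  "gauss_law s = (if s = 0 then return borel 0
     else density lborel (\<lambda>x. ennreal (\<Prod>b\<in>Basis. normal_density 0 (sqrt s) (x \<bullet> b))))"

lemma sets_gauss_law [simp, measurable_cong]: "sets (gauss_law s) = sets borel"
  by (simp add: gauss_law_def)

lemma space_gauss_law [simp]: "space (gauss_law s) = UNIV"
  by (simp add: gauss_law_def)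

lemma nn_integral_normal_density:
  assumes "0 < \<sigma>"
  shows "(\<integral>\<^sup>+x. ennreal (normal_density \<mu> \<sigma> x) \<partial>lborel) = 1"
  using prob_space.emeasure_space_1[OF prob_space_normal_density[OF assms, of \<mu>]]
  by (simp add: emeasure_density)

lemma nn_integral_gauss_law_prod:
  fixes f :: "'a::euclidean_space \<Rightarrow> real \<Rightarrow> ennreal"
  assumes "0 < s" and [measurable]: "\<And>b. b \<in> Basis \<Longrightarrow> f b \<in> borel_measurable borel"
  shows "(\<integral>\<^sup>+x. (\<Prod>b\<in>Basis. f b (x \<bullet> b)) \<partial>gauss_law s) =
    (\<Prod>b\<in>Basis. \<integral>\<^sup>+x. ennreal (normal_density 0 (sqrt s) x) * f b x \<partial>lborel)"
proof -
  have "(\<integral>\<^sup>+x. (\<Prod>b\<in>Basis. f b (x \<bullet> b)) \<partial>gauss_law s) =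
    (\<integral>\<^sup>+x. (\<Prod>b\<in>Basis. ennreal (normal_density 0 (sqrt s) (x \<bullet> b)) * f b (x \<bullet> b)) \<partial>lborel)"
    using assms(1)
    by (simp add: gauss_law_def nn_integral_density prod.distrib prod_ennreal)
  also have "\<dots> = (\<Prod>b\<in>Basis. \<integral>\<^sup>+x. ennreal (normal_density 0 (sqrt s) x) * f b x \<partial>lborel)"
    by (rule nn_integral_lborel_prod) auto
  finally show ?thesis .
qed

lemma prob_space_gauss_law:
  assumes "0 \<le> s"
  shows "prob_space (gauss_law s :: 'a::euclidean_space measure)"
proof (cases "s = 0")
  \<comment> \<open>At \<open>s = 0\<close> the Gaussian formula evaluates to \<open>0\<close>,
    since \<open>1 / 0 = 0\<close>. The point mass at the origin in \<open>gauss_law\<close>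
    replaces it and serves the time \<open>0\<close> term of occupation sums.\<close>
  case True
  then show ?thesis by (simp add: gauss_law_def prob_space_return)
next
  case False
  with assms have "0 < s" by simp
  then have "(\<integral>\<^sup>+x. (\<Prod>b\<in>Basis. (\<lambda>_ _. 1) b (x \<bullet> b)) \<partial>(gauss_law s :: 'a measure)) = 1"
    by (subst nn_integral_gauss_law_prod) (simp_all add: nn_integral_normal_density)
  then show ?thesis by (intro prob_spaceI) simp
qed

lemma integral_gauss_law_prod:
  fixes f :: "'a::euclidean_space \<Rightarrow> real \<Rightarrow> real"
  assumes "0 < s" and [measurable]: "\<And>b. b \<in> Basis \<Longrightarrow> f b \<in> borel_measurable borel"
    and int: "\<And>b. b \<in> Basis \<Longrightarrow> integrable lborel (\<lambda>x. normal_density 0 (sqrt s) x * f b x)"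
  shows "(\<integral>x. (\<Prod>b\<in>Basis. f b (x \<bullet> b)) \<partial>gauss_law s) =
    (\<Prod>b\<in>Basis. \<integral>x. normal_density 0 (sqrt s) x * f b x \<partial>lborel)"
proof -
  interpret product_sigma_finite "\<lambda>_::'a. lborel :: real measure" ..
  have "(\<integral>x. (\<Prod>b\<in>Basis. f b (x \<bullet> b)) \<partial>gauss_law s) =
    (\<integral>x. (\<Prod>b\<in>Basis. normal_density 0 (sqrt s) (x \<bullet> b) * f b (x \<bullet> b)) \<partial>lborel)"
    using assms(1)
    by (simp add: gauss_law_def integral_density prod.distrib prod_nonneg)
  also have "\<dots> = (\<integral>x. (\<Prod>b\<in>Basis. normal_density 0 (sqrt s) (x b) * f b (x b))
      \<partial>(\<Pi>\<^sub>M b\<in>Basis. lborel))"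
    by (subst lborel_eq, subst integral_distr) (auto intro!: Bochner_Integration.integral_cong prod.cong)
  also have "\<dots> = (\<Prod>b\<in>Basis. \<integral>x. normal_density 0 (sqrt s) x * f b x \<partial>lborel)"
    by (rule product_integral_prod) (auto intro: int)
  finally show ?thesis .
qed

lemma integrable_normal_density_bounded:
  assumes "0 < s" and [measurable]: "f \<in> borel_measurable borel" and "\<And>x. \<bar>f x\<bar> \<le> 1"
  shows "integrable lborel (\<lambda>x. normal_density 0 (sqrt s) x * f x)"
proof -
  interpret N: prob_space "density lborel (normal_density 0 (sqrt s))"
    using assms(1) by (simp add: prob_space_normal_density)
  have "integrable (density lborel (normal_density 0 (sqrt s))) f"
    using assms(3) by (intro N.integrable_const_bound[where B=1]) auto
  then show ?thesis by (simp add: integrable_density)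
qed

text \<open>The real part of the characteristic function: \<open>cos (a * y)\<close> is an
  eigenfunction of the heat semigroup, with factor \<open>exp (- (a\<^sup>2 * s / 2))\<close>.
  Variance \<open>s\<close> is reduced to the standard normal law by scaling with
  \<open>sqrt s\<close>.\<close>

lemma normal_cos:
  assumes "0 < s"
  shows "integrable lborel (\<lambda>x. normal_density 0 (sqrt s) x * cos (a * (y + x)))"
    and "(\<integral>x. normal_density 0 (sqrt s) x * cos (a * (y + x)) \<partial>lborel) =
      exp (- (a\<^sup>2 * s / 2)) * cos (a * y)"
proof -
  interpret Z: real_distribution std_normal_distribution
    by (rule real_dist_normal_dist)
  show "integrable lborel (\<lambda>x. normal_density 0 (sqrt s) x * cos (a * (y + x)))"
    using assms by (rule integrable_normal_density_bounded) auto
  have scale: "density lborel (normal_density 0 (sqrt s)) =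
      distr std_normal_distribution borel (\<lambda>x. sqrt s * x)"
  proof -
    have "distributed std_normal_distribution lborel (\<lambda>x. x) (\<lambda>x. ennreal (normal_density 0 1 x))"
      by (simp add: distributed_def distr_id2)
    from Z.normal_density_affine[OF this, of "sqrt s" 0] assms
    have "distributed std_normal_distribution lborel (\<lambda>x. sqrt s * x) (normal_density 0 (sqrt s))"
      by simp
    then have "distr std_normal_distribution lborel (\<lambda>x. sqrt s * x) = density lborel (normal_density 0 (sqrt s))"
      by (simp add: distributed_def)
    moreover have "distr std_normal_distribution lborel (\<lambda>x. sqrt s * x) = distr std_normal_distribution borel (\<lambda>x. sqrt s * x)"
      by (rule distr_cong) auto
    ultimately show ?thesis by simp
  qed
  define c where "c = a * sqrt s"
  have int: "integrable std_normal_distribution (\<lambda>x. iexp (c * x))"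
    by (intro Z.integrable_const_bound[where B=1]) auto
  have "(CLINT x|std_normal_distribution. iexp (c * x)) = of_real (exp (- (c\<^sup>2) / 2))"
    using char_std_normal_distribution by (simp add: char_def fun_eq_iff)
  then have char: "(CLINT x|std_normal_distribution. iexp (a * y) * iexp (c * x)) =
      iexp (a * y) * of_real (exp (- (c\<^sup>2) / 2))"
    by (simp only: integral_mult_right_zero)
  have "(\<integral>x. normal_density 0 (sqrt s) x * cos (a * (y + x)) \<partial>lborel) =
    (\<integral>x. cos (a * (y + x)) \<partial>density lborel (normal_density 0 (sqrt s)))"
    by (simp add: integral_density)
  also have "\<dots> = (\<integral>x. cos (a * y + c * x) \<partial>std_normal_distribution)"
    unfolding scale by (subst integral_distr) (auto simp: c_def algebra_simps)
  also have "\<dots> = (\<integral>x. Re (iexp (a * y) * iexp (c * x)) \<partial>std_normal_distribution)"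
    by (intro Bochner_Integration.integral_cong) (auto simp: Re_exp cos_add exp_add[symmetric] algebra_simps)
  also have "\<dots> = Re (CLINT x|std_normal_distribution. iexp (a * y) * iexp (c * x))"
    using int by (intro integral_Re) auto
  also have "\<dots> = exp (- (a\<^sup>2 * s / 2)) * cos (a * y)"
    unfolding char using assms by (simp add: c_def Re_exp power_mult_distrib)
  finally show "(\<integral>x. normal_density 0 (sqrt s) x * cos (a * (y + x)) \<partial>lborel) =
      exp (- (a\<^sup>2 * s / 2)) * cos (a * y)" .
qed

lemma prod_normal_density:
  fixes x :: "'a::euclidean_space"
  assumes "0 < s"
  shows "(\<Prod>b\<in>Basis. normal_density 0 (sqrt s) (x \<bullet> b)) =
    (1 / sqrt (2 * pi * s)) ^ DIM('a) * exp (- ((norm x)\<^sup>2 / (2 * s)))"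
proof -
  have "(\<Prod>b\<in>Basis. normal_density 0 (sqrt s) (x \<bullet> b)) =
    (\<Prod>b\<in>Basis. (1 / sqrt (2 * pi * s)) * exp (- ((x \<bullet> b)\<^sup>2 / (2 * s))))"
    using assms by (simp add: normal_density_def)
  also have "\<dots> = (1 / sqrt (2 * pi * s)) ^ DIM('a) * exp (\<Sum>b\<in>Basis. - ((x \<bullet> b)\<^sup>2 / (2 * s)))"
    by (simp only: prod.distrib exp_sum[OF finite_Basis] prod_constant)
  also have "(\<Sum>b\<in>Basis. - ((x \<bullet> b)\<^sup>2 / (2 * s))) = - ((norm x)\<^sup>2 / (2 * s))"
    unfolding power2_norm_eq_inner
    by (subst (2) euclidean_inner) (simp add: sum_negf sum_divide_distrib power2_eq_square)
  finally show ?thesis .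
qed

lemma density_gauss_law_plane:
  fixes x :: "real ^ 2"
  assumes "0 < s"
  shows "(\<Prod>b\<in>Basis. normal_density 0 (sqrt s) (x \<bullet> b)) =
    exp (- ((norm x)\<^sup>2 / (2 * s))) / (2 * pi * s)"
  using assms by (subst prod_normal_density) (auto simp: power2_eq_square)

lemma emeasure_gauss_law_plane_le:
  fixes A :: "(real ^ 2) set"
  assumes "0 < s" and [measurable]: "A \<in> sets borel"
  shows "emeasure (gauss_law s) A \<le> ennreal (1 / (2 * pi * s)) * emeasure lborel A"
proof -
  have "emeasure (gauss_law s) A = (\<integral>\<^sup>+x. ennreal (exp (- ((norm x)\<^sup>2 / (2 * s))) / (2 * pi * s)) * indicator A x \<partial>lborel)"
    using assms by (simp add: gauss_law_def emeasure_density density_gauss_law_plane)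
  also have "\<dots> \<le> (\<integral>\<^sup>+x. ennreal (1 / (2 * pi * s)) * indicator A x \<partial>lborel)"
    using assms(1) by (intro nn_integral_mono mult_right_mono ennreal_leI divide_right_mono) auto
  also have "\<dots> = ennreal (1 / (2 * pi * s)) * emeasure lborel A"
    by (subst nn_integral_cmult_indicator) auto
  finally show ?thesis .
qed

lemma emeasure_gauss_law_plane_ge:
  fixes A :: "(real ^ 2) set"
  assumes "0 < s" and [measurable]: "A \<in> sets borel" and le: "\<And>x. x \<in> A \<Longrightarrow> norm x \<le> l"
  shows "ennreal (exp (- (l\<^sup>2 / (2 * s))) / (2 * pi * s)) * emeasure lborel A \<le> emeasure (gauss_law s) A"
proof -
  have "ennreal (exp (- (l\<^sup>2 / (2 * s))) / (2 * pi * s)) * emeasure lborel A =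
    (\<integral>\<^sup>+x. ennreal (exp (- (l\<^sup>2 / (2 * s))) / (2 * pi * s)) * indicator A x \<partial>lborel)"
    by (subst nn_integral_cmult_indicator) auto
  also have "\<dots> \<le> (\<integral>\<^sup>+x. ennreal (exp (- ((norm x)\<^sup>2 / (2 * s))) / (2 * pi * s)) * indicator A x \<partial>lborel)"
    using assms(1) le
    by (intro nn_integral_mono) (auto split: split_indicator intro!: ennreal_leI divide_right_mono power_mono)
  also have "\<dots> = emeasure (gauss_law s) A"
    using assms by (simp add: gauss_law_def emeasure_density density_gauss_law_plane)
  finally show ?thesis .
qed

section \<open>Random walks\<close>

definition walk :: "(nat \<Rightarrow> 'a::comm_monoid_add) \<Rightarrow> nat \<Rightarrow> 'a" where
  "walk \<omega> k = (\<Sum>j<k. \<omega> j)"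

lemma walk_0 [simp]: "walk \<omega> 0 = 0"
  by (simp add: walk_def)

lemma walk_case_nat [simp]: "walk (case_nat z \<omega>) (Suc k) = z + walk \<omega> k"
  by (simp add: walk_def sum.lessThan_Suc_shift del: sum.lessThan_Suc)

text \<open>The sample space carries the steps, not the positions. Splitting off the first
  coordinate of the product is then the Markov property, and the starting point stays a free
  parameter that can be integrated over.\<close>

locale random_walk = sequence_space \<nu> for \<nu> :: "'a::euclidean_space measure" +
  assumes sets_step [simp, measurable_cong]: "sets \<nu> = sets borel"
begin

text \<open>The sets depend on time because a frozen target path turns the discs around it into a
  deterministic moving family. Times \<open>0\<close> and \<open>n\<close> are both watched, hence
  the factors \<open>Suc n\<close> later.\<close>

definition hit :: "nat \<Rightarrow> (nat \<Rightarrow> 'a set) \<Rightarrow> 'a \<Rightarrow> ennreal" where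
  "hit n B x = emeasure S {\<omega>\<in>space S. \<exists>k\<le>n. x + walk \<omega> k \<in> B k}"

text \<open>The expected number of visits: the Green function truncated at time \<open>n\<close>,
  for a moving set.\<close>

definition occ :: "nat \<Rightarrow> (nat \<Rightarrow> 'a set) \<Rightarrow> 'a \<Rightarrow> ennreal" where
  "occ n B x = (\<Sum>k\<le>n. emeasure S {\<omega>\<in>space S. x + walk \<omega> k \<in> B k})"

lemma space_step [simp]: "space \<nu> = UNIV"
  using sets_eq_imp_space_eq[OF sets_step] by simp

lemma walk_measurable [measurable]: "(\<lambda>\<omega>. walk \<omega> k) \<in> borel_measurable S"
  unfolding walk_def by measurable

text \<open>The Markov property at time \<open>1\<close>: prepending an independent step maps
  \<open>\<nu> \<Otimes>\<^sub>M S\<close> back to \<open>S\<close>.\<close>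

lemma emeasure_first_step:
  assumes [measurable]: "Measurable.pred S P"
  shows "emeasure S {\<omega>\<in>space S. P \<omega>} =
    (\<integral>\<^sup>+z. emeasure S {\<omega>\<in>space S. P (case_nat z \<omega>)} \<partial>\<nu>)"
proof -
  have [measurable]: "(\<lambda>(z, \<omega>). case_nat z \<omega>) \<in> \<nu> \<Otimes>\<^sub>M S \<rightarrow>\<^sub>M S"
    by measurable
  have "emeasure S {\<omega>\<in>space S. P \<omega>} = emeasure (distr (\<nu> \<Otimes>\<^sub>M S) S (\<lambda>(z, \<omega>). case_nat z \<omega>)) {\<omega>\<in>space S. P \<omega>}"
    by (simp add: PiM_iter)
  also have "\<dots> = emeasure (\<nu> \<Otimes>\<^sub>M S) {p\<in>space (\<nu> \<Otimes>\<^sub>M S). P (case_nat (fst p) (snd p))}"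
  proof -
    have "{\<omega>\<in>space S. P \<omega>} \<in> sets S"
      by measurable
    then show ?thesis
      by (subst emeasure_distr)
        (auto simp: space_pair_measure space_PiM split: nat.split intro!: arg_cong[where f="emeasure _"])
  qed
  also have "\<dots> = (\<integral>\<^sup>+z. emeasure S (Pair z -` {p\<in>space (\<nu> \<Otimes>\<^sub>M S). P (case_nat (fst p) (snd p))}) \<partial>\<nu>)"
    by (rule emeasure_pair_measure_alt) measurable
  also have "\<dots> = (\<integral>\<^sup>+z. emeasure S {\<omega>\<in>space S. P (case_nat z \<omega>)} \<partial>\<nu>)"
    by (intro nn_integral_cong arg_cong[where f="emeasure _"]) (auto simp: space_pair_measure)
  finally show ?thesis .
qed

lemma hit_measurable [measurable]:
  assumes [measurable]: "\<And>k. B k \<in> sets borel"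
  shows "hit n B \<in> borel_measurable borel"
proof -
  let ?Q = "{p\<in>space (borel \<Otimes>\<^sub>M S). \<exists>k\<le>n. fst p + walk (snd p) k \<in> B k}"
  have "(\<lambda>x. emeasure S (Pair x -` ?Q)) \<in> borel_measurable borel"
    by (rule measurable_emeasure_Pair) measurable
  also have "(\<lambda>x. emeasure S (Pair x -` ?Q)) = hit n B"
    by (auto simp: hit_def fun_eq_iff space_pair_measure intro!: arg_cong[where f="emeasure S"])
  finally show ?thesis .
qed

lemma occ_measurable [measurable]:
  assumes [measurable]: "\<And>k. B k \<in> sets borel"
  shows "occ n B \<in> borel_measurable borel"
proof -
  have "(\<lambda>x. emeasure S {\<omega>\<in>space S. x + walk \<omega> k \<in> B k}) \<in> borel_measurable borel" for k
  proof -
    let ?Q = "{p\<in>space (borel \<Otimes>\<^sub>M S). fst p + walk (snd p) k \<in> B k}"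
    have "(\<lambda>x. emeasure S (Pair x -` ?Q)) \<in> borel_measurable borel"
      by (rule measurable_emeasure_Pair) measurable
    also have "(\<lambda>x. emeasure S (Pair x -` ?Q)) = (\<lambda>x. emeasure S {\<omega>\<in>space S. x + walk \<omega> k \<in> B k})"
      by (auto simp: fun_eq_iff space_pair_measure intro!: arg_cong[where f="emeasure S"])
    finally show ?thesis .
  qed
  then show ?thesis
    unfolding occ_def by measurable
qed

lemma hit_le_1: "hit n B x \<le> 1"
  unfolding hit_def by (rule P.emeasure_le_1)

lemma ennreal_enn2real_hit: "ennreal (enn2real (hit n B x)) = hit n B x"
  by (rule ennreal_enn2real[OF le_less_trans[OF hit_le_1 ennreal_one_less_top]])

lemma hit_eq_1: "x \<in> B 0 \<Longrightarrow> hit n B x = 1"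
  unfolding hit_def using P.emeasure_space_1
  by (auto intro!: trans[OF arg_cong[where f="emeasure S"] P.emeasure_space_1] exI[of _ 0])

lemma hit_0: "hit 0 B x = indicator (B 0) x"
  by (simp add: hit_def P.emeasure_space_1 split: split_indicator)

text \<open>Away from \<open>B 0\<close> only the times from \<open>1\<close> on matter, so
  conditioning on the first step shifts the family by one. On \<open>B 0\<close> the value is
  \<open>1\<close>. This recursion drives the inductions that stand in for stopping times.\<close>

lemma hit_Suc:
  assumes [measurable]: "\<And>k. B k \<in> sets borel" and "x \<notin> B 0"
  shows "hit (Suc n) B x = (\<integral>\<^sup>+z. hit n (\<lambda>k. B (Suc k)) (x + z) \<partial>\<nu>)"
proof -
  have "hit (Suc n) B x = (\<integral>\<^sup>+z. emeasure S {\<omega>\<in>space S. \<exists>k\<le>Suc n. x + walk (case_nat z \<omega>) k \<in> B k} \<partial>\<nu>)"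
    unfolding hit_def by (rule emeasure_first_step) measurable
  moreover have "(\<exists>k\<le>Suc n. x + walk (case_nat z \<omega>) k \<in> B k) \<longleftrightarrow>
      (\<exists>k\<le>n. x + z + walk \<omega> k \<in> B (Suc k))" for z \<omega>
    using assms(2) by (auto simp: ex_simps less_Suc_eq_le[symmetric] Ex_less_Suc2 add.assoc)
  ultimately show ?thesis
    by (simp add: hit_def)
qed

lemma occ_0: "occ 0 B x = indicator (B 0) x"
  by (simp add: occ_def P.emeasure_space_1 split: split_indicator)

lemma occ_Suc:
  assumes [measurable]: "\<And>k. B k \<in> sets borel"
  shows "occ (Suc n) B x = indicator (B 0) x + (\<integral>\<^sup>+z. occ n (\<lambda>k. B (Suc k)) (x + z) \<partial>\<nu>)"
proof -
  have step: "emeasure S {\<omega>\<in>space S. x + walk \<omega> (Suc k) \<in> B (Suc k)} =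
      (\<integral>\<^sup>+z. emeasure S {\<omega>\<in>space S. x + z + walk \<omega> k \<in> B (Suc k)} \<partial>\<nu>)" for k
    by (subst emeasure_first_step) (auto simp: add.assoc)
  have [measurable]: "(\<lambda>z. emeasure S {\<omega>\<in>space S. x + z + walk \<omega> k \<in> B (Suc k)}) \<in> borel_measurable \<nu>" for k
  proof -
    let ?Q = "{p\<in>space (\<nu> \<Otimes>\<^sub>M S). x + fst p + walk (snd p) k \<in> B (Suc k)}"
    have "(\<lambda>z. emeasure S (Pair z -` ?Q)) \<in> borel_measurable \<nu>"
      by (rule measurable_emeasure_Pair) measurable
    also have "(\<lambda>z. emeasure S (Pair z -` ?Q)) = (\<lambda>z. emeasure S {\<omega>\<in>space S. x + z + walk \<omega> k \<in> B (Suc k)})"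
      by (auto simp: fun_eq_iff space_pair_measure intro!: arg_cong[where f="emeasure S"])
    finally show ?thesis .
  qed
  have "occ (Suc n) B x = occ 0 B x + (\<Sum>k\<le>n. emeasure S {\<omega>\<in>space S. x + walk \<omega> (Suc k) \<in> B (Suc k)})"
    unfolding occ_def by (subst sum.atMost_Suc_shift) simp
  also have "\<dots> = indicator (B 0) x + (\<integral>\<^sup>+z. occ n (\<lambda>k. B (Suc k)) (x + z) \<partial>\<nu>)"
    unfolding step occ_0 by (subst nn_integral_sum[symmetric]) (simp_all add: occ_def)
  finally show ?thesis .
qed

section \<open>Comparing hitting probabilities with occupation numbers\<close>

lemma occ_mono: "m \<le> n \<Longrightarrow> occ m B x \<le> occ n B x"
  unfolding occ_def by (rule sum_mono2) auto

lemma hit_le_occ: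
  assumes [measurable]: "\<And>k. B k \<in> sets borel"
  shows "hit n B x \<le> occ n B x"
proof -
  have "{\<omega>\<in>space S. \<exists>k\<le>n. x + walk \<omega> k \<in> B k} = (\<Union>k\<in>{..n}. {\<omega>\<in>space S. x + walk \<omega> k \<in> B k})"
    by auto
  then show ?thesis
    unfolding hit_def occ_def by (simp only:) (rule emeasure_subadditive_finite; auto)
qed

text \<open>First-entrance decomposition: after the first visit the walk starts afresh.\<close>

lemma occ_le_hit:
  assumes "\<And>k. B k \<in> sets borel"
    and "\<And>j m y. j + m \<le> n \<Longrightarrow> occ m (\<lambda>k. B (j + k)) y \<le> C"
  shows "occ n B x \<le> C * hit n B x"
  using assms
proof (induction n arbitrary: B x)
  case 0
  show ?case
    using "0.prems"(2)[of 0 0 x] by (auto simp: occ_0 hit_0 split: split_indicator)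
next
  case (Suc n)
  note [measurable] = Suc.prems(1)
  show ?case
  proof (cases "x \<in> B 0")
    case True
    then show ?thesis
      using Suc.prems(2)[of 0 "Suc n" x] by (simp add: hit_eq_1)
  next
    case False
    have IH: "occ n (\<lambda>k. B (Suc k)) y \<le> C * hit n (\<lambda>k. B (Suc k)) y" for y
      using Suc.prems(2)[of "Suc j" for j] by (intro Suc.IH) auto
    have "occ (Suc n) B x = (\<integral>\<^sup>+z. occ n (\<lambda>k. B (Suc k)) (x + z) \<partial>\<nu>)"
      using False by (subst occ_Suc) auto
    also have "\<dots> \<le> (\<integral>\<^sup>+z. C * hit n (\<lambda>k. B (Suc k)) (x + z) \<partial>\<nu>)"
      by (intro nn_integral_mono IH)
    also have "\<dots> = C * hit (Suc n) B x"
      using False by (subst nn_integral_cmult) (auto simp: hit_Suc)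
    finally show ?thesis .
  qed
qed

text \<open>An entrance by time \<open>n\<close> leaves \<open>u\<close> further steps, which yield
  at least \<open>c\<close> visits on average from any point of \<open>A\<close>. This is the
  converse of \<open>occ_le_hit\<close>, at the price of the longer window
  \<open>n + u\<close>.\<close>

lemma hit_le_occ_later:
  assumes [measurable]: "A \<in> sets borel"
    and "\<And>y. y \<in> A \<Longrightarrow> c \<le> occ u (\<lambda>_. A) y"
  shows "c * hit n (\<lambda>_. A) x \<le> occ (n + u) (\<lambda>_. A) x"
proof (induction n arbitrary: x)
  case 0
  then show ?case
    using assms(2)[of x] by (auto simp: hit_0 split: split_indicator)
next
  case (Suc n)
  show ?case
  proof (cases "x \<in> A")
    case True
    have "c \<le> occ u (\<lambda>_. A) x"
      using True by (rule assms(2))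
    also have "\<dots> \<le> occ (Suc n + u) (\<lambda>_. A) x"
      by (rule occ_mono) simp
    finally show ?thesis
      using True by (simp add: hit_eq_1)
  next
    case False
    then have "c * hit (Suc n) (\<lambda>_. A) x = (\<integral>\<^sup>+z. c * hit n (\<lambda>_. A) (x + z) \<partial>\<nu>)"
      by (simp add: hit_Suc nn_integral_cmult)
    also have "\<dots> \<le> (\<integral>\<^sup>+z. occ (n + u) (\<lambda>_. A) (x + z) \<partial>\<nu>)"
      by (intro nn_integral_mono Suc.IH)
    also have "\<dots> = occ (Suc n + u) (\<lambda>_. A) x"
      using False by (simp add: occ_Suc)
    finally show ?thesis .
  qed
qed

text \<open>By Tonelli the starting point is integrated first, for a fixed step sequence; there the
  shift by \<open>walk \<omega> k\<close> preserves Lebesgue measure, separately for each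
  \<open>k\<close>.\<close>

lemma nn_integral_occ:
  assumes [measurable]: "\<And>k. B k \<in> sets borel"
  shows "(\<integral>\<^sup>+x. occ n B x \<partial>lborel) = (\<Sum>k\<le>n. emeasure lborel (B k))"
proof -
  interpret LS: pair_sigma_finite "lborel :: 'a measure" S ..
  have single: "(\<integral>\<^sup>+x. emeasure S {\<omega>\<in>space S. x + walk \<omega> k \<in> B k} \<partial>lborel) = emeasure lborel (B k)"
    and [measurable]: "(\<lambda>x. emeasure S {\<omega>\<in>space S. x + walk \<omega> k \<in> B k}) \<in> borel_measurable borel" for k
  proof -
    let ?f = "\<lambda>x \<omega>. indicator (B k) (x + walk \<omega> k) :: ennreal"
    have eq: "emeasure S {\<omega>\<in>space S. x + walk \<omega> k \<in> B k} = (\<integral>\<^sup>+\<omega>. ?f x \<omega> \<partial>S)" for x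
    proof -
      have "{\<omega>\<in>space S. x + walk \<omega> k \<in> B k} \<in> sets S"
        by measurable
      then have "emeasure S {\<omega>\<in>space S. x + walk \<omega> k \<in> B k} =
          (\<integral>\<^sup>+\<omega>. indicator {\<omega>\<in>space S. x + walk \<omega> k \<in> B k} \<omega> \<partial>S)"
        by (rule nn_integral_indicator[symmetric])
      also have "\<dots> = (\<integral>\<^sup>+\<omega>. ?f x \<omega> \<partial>S)"
        by (rule nn_integral_cong) (simp split: split_indicator)
      finally show ?thesis .
    qed
    show "(\<lambda>x. emeasure S {\<omega>\<in>space S. x + walk \<omega> k \<in> B k}) \<in> borel_measurable borel"
      unfolding eq by measurable
    have shift: "(\<integral>\<^sup>+x. ?f x \<omega> \<partial>lborel) = emeasure lborel (B k)" for \<omega>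
    proof -
      have "emeasure lborel (B k) = (\<integral>\<^sup>+x. indicator (B k) x \<partial>distr lborel borel ((+) (walk \<omega> k)))"
        by (simp add: lborel_distr_plus)
      also have "\<dots> = (\<integral>\<^sup>+x. ?f x \<omega> \<partial>lborel)"
        by (subst nn_integral_distr) (auto simp: add.commute)
      finally show ?thesis ..
    qed
    have "(\<integral>\<^sup>+x. (\<integral>\<^sup>+\<omega>. ?f x \<omega> \<partial>S) \<partial>lborel) = (\<integral>\<^sup>+\<omega>. (\<integral>\<^sup>+x. ?f x \<omega> \<partial>lborel) \<partial>S)"
      by (rule LS.Fubini'[symmetric]) measurable
    then show "(\<integral>\<^sup>+x. emeasure S {\<omega>\<in>space S. x + walk \<omega> k \<in> B k} \<partial>lborel) = emeasure lborel (B k)"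
      unfolding eq shift by (simp add: P.emeasure_space_1)
  qed
  show ?thesis
    unfolding occ_def by (subst nn_integral_sum) (auto simp: single)
qed

text \<open>The test function \<open>\<phi>\<close> stands in for a Dirichlet eigenfunction of \<open>D\<close>; the slack \<open>e\<close> pays for the
  jumps of the walk.\<close>

lemma hit_complement_le:
  assumes [measurable]: "D \<in> sets borel" "\<phi> \<in> borel_measurable borel"
    and off: "\<And>y. y \<notin> D \<Longrightarrow> \<phi> y \<le> 0" and bound: "\<And>y. \<bar>\<phi> y\<bar> \<le> 1"
    and q: "0 \<le> q" "q \<le> 1" and e: "0 \<le> e"
    and step: "\<And>y. y \<in> D \<Longrightarrow> q * \<phi> y - e \<le> (\<integral>z. \<phi> (y + z) \<partial>\<nu>)"
  shows "hit n (\<lambda>_. - D) x \<le> ennreal (1 - q ^ n * \<phi> x + n * e)"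
proof (induction n arbitrary: x)
  case 0
  then show ?case
    using off[of x] bound[of x] by (auto simp: hit_0 split: split_indicator intro!: ennreal_leI[of 1, simplified])
next
  \<comment> \<open>The right side is a supersolution of the first-step recursion. Off
    \<open>D\<close> it is at least \<open>1\<close>, because \<open>\<phi>\<close> is at most
    \<open>0\<close> there. On \<open>D\<close> the loss \<open>q ^ n * e\<close> of one step is
    paid by the growth of the last summand.\<close>
  case (Suc n)
  show ?case
  proof (cases "x \<in> D")
    case False
    have "hit (Suc n) (\<lambda>_. - D) x \<le> ennreal 1"
      using hit_le_1 by simp
    also have "\<dots> \<le> ennreal (1 - q ^ Suc n * \<phi> x + real (Suc n) * e)"
    proof (rule ennreal_leI)
      have "q ^ Suc n * \<phi> x \<le> 0"
        using off[OF False] q by (simp add: mult_nonneg_nonpos)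
      moreover have "0 \<le> real (Suc n) * e"
        using e by simp
      ultimately show "1 \<le> 1 - q ^ Suc n * \<phi> x + real (Suc n) * e"
        by linarith
    qed
    finally show ?thesis .
  next
    case True
    have int: "integrable \<nu> (\<lambda>z. \<phi> (x + z))"
      by (rule M.integrable_const_bound[where B=1]) (auto intro!: bound)
    have qn: "0 \<le> q ^ n" "q ^ n \<le> 1"
      using q by (auto intro: power_le_one)
    \<comment> \<open>\<open>ennreal\<close> truncates at \<open>0\<close>, so the bound has to be
      nonnegative before its \<open>nn_integral\<close> can be turned into the Lebesgue integral
      that \<open>step\<close> controls.\<close>
    have nonneg: "0 \<le> 1 - q ^ n * \<phi> y + n * e" for y
    proof -
      have "q ^ n * \<phi> y \<le> q ^ n * 1"
        using qn bound[of y] by (intro mult_left_mono) auto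
      then show ?thesis
        using qn e by (simp add: add_nonneg_nonneg)
    qed
    have "hit (Suc n) (\<lambda>_. - D) x = (\<integral>\<^sup>+z. hit n (\<lambda>_. - D) (x + z) \<partial>\<nu>)"
      using True by (subst hit_Suc) auto
    also have "\<dots> \<le> (\<integral>\<^sup>+z. ennreal (1 - q ^ n * \<phi> (x + z) + n * e) \<partial>\<nu>)"
      by (intro nn_integral_mono Suc.IH)
    also have "\<dots> = ennreal (\<integral>z. 1 - q ^ n * \<phi> (x + z) + n * e \<partial>\<nu>)"
      using int by (intro nn_integral_eq_integral) (auto intro: nonneg)
    also have "(\<integral>z. 1 - q ^ n * \<phi> (x + z) + n * e \<partial>\<nu>) = 1 - q ^ n * (\<integral>z. \<phi> (x + z) \<partial>\<nu>) + n * e"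
      using int M.prob_space by simp
    also have "ennreal \<dots> \<le> ennreal (1 - q ^ Suc n * \<phi> x + real (Suc n) * e)"
    proof (rule ennreal_leI)
      have "q ^ n * (q * \<phi> x - e) \<le> q ^ n * (\<integral>z. \<phi> (x + z) \<partial>\<nu>)"
        using step[OF True] qn by (intro mult_left_mono) auto
      moreover have "q ^ n * e \<le> e"
        using qn e by (simp add: mult_left_le_one_le)
      ultimately show "1 - q ^ n * (\<integral>z. \<phi> (x + z) \<partial>\<nu>) + n * e \<le> 1 - q ^ Suc n * \<phi> x + real (Suc n) * e"
        by (simp add: algebra_simps)
    qed
    finally show ?thesis .
  qed
qed

end

lemma random_walk_gauss_law: "0 \<le> s \<Longrightarrow> random_walk (gauss_law s)"
  unfolding random_walk_def random_walk_axioms_def sequence_space_def product_prob_space_def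
    product_sigma_finite_def product_prob_space_axioms_def
  by (simp add: prob_space_gauss_law prob_space_imp_sigma_finite)

section \<open>Brownian motion on a time grid\<close>

definition increments :: "real \<Rightarrow> (real \<Rightarrow> 'a::euclidean_space) \<Rightarrow> nat \<Rightarrow> 'a" where
  "increments \<delta> p k = p (real (Suc k) * \<delta>) - p (real k * \<delta>)"

lemma walk_increments: "walk (increments \<delta> p) k = p (real k * \<delta>) - p 0"
  using sum_lessThan_telescope[of "\<lambda>k. p (real k * \<delta>)" k]
  by (simp add: walk_def increments_def)

lemma path_space_component:
  "0 \<le> s \<Longrightarrow> (\<lambda>p. p s) \<in> measurable path_space borel"
  unfolding path_space_def by (rule measurable_component_singleton) simp

lemma increments_measurable [measurable]:
  "0 \<le> \<delta> \<Longrightarrow> increments \<delta> \<in> measurable path_space (\<Pi>\<^sub>M k\<in>UNIV. borel)"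
  unfolding increments_def
  by (intro measurable_PiM_single' borel_measurable_diff path_space_component)
    (auto simp: space_PiM)

lemma sample_path_eq: "0 \<le> s \<Longrightarrow> sample_path B \<omega> s = B s \<omega>"
  by (simp add: sample_path_def)

lemma sample_path_measurable [measurable]:
  "continuous_process M B \<Longrightarrow> sample_path B \<in> measurable M path_space"
  unfolding sample_path_def path_space_def continuous_process_def
  by (intro measurable_restrict) auto

context prob_space
begin

lemma distr_increment:
  assumes B: "standard_brownian_motion M B" and "0 \<le> s" "s \<le> t"
  shows "distr M borel (\<lambda>\<omega>. B t \<omega> - B s \<omega>) = gauss_law (t - s)"
proof (cases "s = t")
  case True
  then show ?thesis
    by (simp add: gauss_law_def distr_const)
next
  case False
  with assms have *: "distributed M lborel (\<lambda>\<omega>. B t \<omega> - B s \<omega>)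
          (\<lambda>x. ennreal (\<Prod>b\<in>Basis. normal_density 0 (sqrt (t - s)) (x \<bullet> b)))"
    by (simp add: standard_brownian_motion_def)
  have "distr M borel (\<lambda>\<omega>. B t \<omega> - B s \<omega>) = distr M lborel (\<lambda>\<omega>. B t \<omega> - B s \<omega>)"
    by (rule distr_cong) auto
  with False show ?thesis
    by (simp add: gauss_law_def distributed_distr_eq_density[OF *])
qed

text \<open>Independence is given for finite increasing time sequences. An infinite family is
  independent once every finite subfamily is, and every finite set of indices lies in an initial
  segment; so the whole grid has product law.\<close>

lemma distr_increments:
  assumes B: "standard_brownian_motion M B" and "0 \<le> \<delta>"
  shows "distr M (\<Pi>\<^sub>M k\<in>UNIV. borel) (\<lambda>\<omega>. increments \<delta> (sample_path B \<omega>)) = (\<Pi>\<^sub>M k\<in>UNIV. gauss_law \<delta>)"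
proof -
  let ?X = "\<lambda>k \<omega>. B (real (Suc k) * \<delta>) \<omega> - B (real k * \<delta>) \<omega>"
  have Bm: "B s \<in> borel_measurable M" if "0 \<le> s" for s
    using B that by (simp add: standard_brownian_motion_def continuous_process_def)
  have rv: "random_variable borel (?X k)" for k
    using assms(2) by (intro borel_measurable_diff Bm) auto
  have fin: "indep_vars (\<lambda>_. borel) ?X {..<n}" for n
  proof -
    have "0 \<le> (\<lambda>k. real k * \<delta>) 0 \<and> (\<forall>k<n. (\<lambda>k. real k * \<delta>) k \<le> (\<lambda>k. real k * \<delta>) (Suc k))"
      using assms(2) by (auto intro: mult_right_mono)
    moreover have "\<forall>n (t :: nat \<Rightarrow> real). 0 \<le> t 0 \<and> (\<forall>k<n. t k \<le> t (Suc k)) \<longrightarrow>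
        indep_vars (\<lambda>_. borel) (\<lambda>k \<omega>. B (t (Suc k)) \<omega> - B (t k) \<omega>) {..<n}"
      using B by (simp add: standard_brownian_motion_def)
    ultimately show ?thesis
      by (elim allE impE)
  qed
  have "indep_sets (\<lambda>k. {?X k -` A \<inter> space M |A. A \<in> sets borel}) J" if J: "finite J" for J :: "nat set"
  proof -
    obtain n where "J \<subseteq> {..<n}"
      using J finite_nat_iff_bounded by blast
    moreover have "indep_sets (\<lambda>k. {?X k -` A \<inter> space M |A. A \<in> sets borel}) {..<n}"
      using fin[of n] unfolding indep_vars_def2 by (rule conjunct2)
    ultimately show ?thesis
      by (rule indep_sets_mono_index)
  qed
  then have "indep_sets (\<lambda>k. {?X k -` A \<inter> space M |A. A \<in> sets borel}) UNIV"
    by (intro iffD2[OF indep_sets_finite_index_sets[of "\<lambda>k. {?X k -` A \<inter> space M |A. A \<in> sets borel}" UNIV]] allI impI)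
  with rv have "indep_vars (\<lambda>_. borel) ?X UNIV"
    unfolding indep_vars_def2 by blast
  then have "distr M (\<Pi>\<^sub>M k\<in>UNIV. borel) (\<lambda>\<omega>. \<lambda>k\<in>UNIV. ?X k \<omega>) = (\<Pi>\<^sub>M k\<in>UNIV. distr M borel (?X k))"
    using rv by (subst indep_vars_iff_distr_eq_PiM[symmetric]) auto
  moreover have "distr M borel (?X k) = gauss_law \<delta>" for k
    using assms by (subst distr_increment) (auto simp: algebra_simps)
  moreover have "increments \<delta> (sample_path B \<omega>) = (\<lambda>k\<in>UNIV. ?X k \<omega>)" for \<omega>
    using assms(2) by (auto simp: increments_def fun_eq_iff sample_path_def)
  ultimately show ?thesis
    by simp
qed

text \<open>Since \<open>B 0 = 0\<close>, the walk driven by the increments telescopes to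
  \<open>B\<close> on the grid, and \<open>distr_increments\<close> identifies the law of those
  increments with the sample space of \<open>random_walk\<close>.\<close>

lemma grid_hit:
  fixes B :: "real \<Rightarrow> 'a \<Rightarrow> 'b::euclidean_space" and x :: 'b
  assumes B: "standard_brownian_motion M B" and \<delta>: "0 \<le> \<delta>" and [measurable]: "\<And>k. C k \<in> sets borel"
  shows "emeasure M {\<omega>\<in>space M. \<exists>k\<le>n. x + B (real k * \<delta>) \<omega> \<in> C k} = random_walk.hit (gauss_law \<delta>) n C x"
proof -
  interpret G: random_walk "gauss_law \<delta> :: 'b measure"
    using \<delta> by (rule random_walk_gauss_law)
  have cp: "continuous_process M B" and B0: "\<And>\<omega>. \<omega> \<in> space M \<Longrightarrow> B 0 \<omega> = 0"
    using B by (auto simp: standard_brownian_motion_def)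
  have [measurable]: "(\<lambda>\<omega>. increments \<delta> (sample_path B \<omega>)) \<in> measurable M (\<Pi>\<^sub>M k\<in>UNIV. borel)"
    using \<delta> cp by (intro measurable_compose[OF sample_path_measurable increments_measurable])
  have [measurable]: "(\<lambda>\<omega>. walk \<omega> k :: 'b) \<in> borel_measurable (\<Pi>\<^sub>M k\<in>UNIV. borel)" for k
    unfolding walk_def by measurable
  have "random_walk.hit (gauss_law \<delta>) n C x =
    emeasure (distr M (\<Pi>\<^sub>M k\<in>UNIV. borel) (\<lambda>\<omega>. increments \<delta> (sample_path B \<omega>)))
      {\<omega>\<in>space (\<Pi>\<^sub>M k\<in>UNIV. borel). \<exists>k\<le>n. x + walk \<omega> k \<in> C k}"
    by (simp add: G.hit_def distr_increments[OF B \<delta>] space_PiM)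
  also have "\<dots> = emeasure M {\<omega>\<in>space M. \<exists>k\<le>n. x + walk (increments \<delta> (sample_path B \<omega>)) k \<in> C k}"
  proof -
    have "{\<omega>\<in>space (\<Pi>\<^sub>M k\<in>UNIV. borel). \<exists>k\<le>n. x + walk \<omega> k \<in> C k} \<in> sets (\<Pi>\<^sub>M k\<in>(UNIV::nat set). borel)"
      by measurable
    then show ?thesis
      by (subst emeasure_distr) (auto simp: space_PiM intro!: arg_cong[where f="emeasure M"])
  qed
  also have "\<dots> = emeasure M {\<omega>\<in>space M. \<exists>k\<le>n. x + B (real k * \<delta>) \<omega> \<in> C k}"
    using \<delta> B0 by (intro arg_cong[where f="emeasure M"] Collect_cong conj_cong refl)
      (simp add: walk_increments sample_path_def)
  finally show ?thesis ..
qed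

text \<open>The Brownian motion acts as a witness that the \<open>k\<close>-fold convolution of
  \<open>gauss_law \<delta>\<close> is \<open>gauss_law (real k * \<delta>)\<close>: both are the
  law of \<open>B (real k * \<delta>) - B 0\<close>.\<close>

lemma grid_occ:
  fixes B :: "real \<Rightarrow> 'a \<Rightarrow> 'b::euclidean_space" and x :: 'b
  assumes B: "standard_brownian_motion M B"
    and \<delta>: "0 \<le> \<delta>" and [measurable]: "\<And>k. C k \<in> sets borel"
  shows "random_walk.occ (gauss_law \<delta>) n C x = (\<Sum>k\<le>n. emeasure (gauss_law (real k * \<delta>)) {z. x + z \<in> C k})"
proof -
  interpret G: random_walk "gauss_law \<delta> :: 'b measure"
    using \<delta> by (rule random_walk_gauss_law)
  have cp: "continuous_process M B" and B0: "\<And>\<omega>. \<omega> \<in> space M \<Longrightarrow> B 0 \<omega> = 0"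
    using B by (auto simp: standard_brownian_motion_def)
  have [measurable]: "(\<lambda>\<omega>. increments \<delta> (sample_path B \<omega>)) \<in> measurable M (\<Pi>\<^sub>M k\<in>UNIV. borel)"
    using \<delta> cp by (intro measurable_compose[OF sample_path_measurable increments_measurable])
  have [measurable]: "(\<lambda>\<omega>. walk \<omega> k :: 'b) \<in> borel_measurable (\<Pi>\<^sub>M k\<in>UNIV. borel)" for k
    unfolding walk_def by measurable
  have Bm: "B s \<in> borel_measurable M" if "0 \<le> s" for s
    using cp that by (simp add: continuous_process_def)
  have "emeasure G.S {\<omega>\<in>space G.S. x + walk \<omega> k \<in> C k} = emeasure (gauss_law (real k * \<delta>)) {z. x + z \<in> C k}" for k
  proof -
    have "emeasure G.S {\<omega>\<in>space G.S. x + walk \<omega> k \<in> C k} =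
      emeasure (distr M (\<Pi>\<^sub>M k\<in>UNIV. borel) (\<lambda>\<omega>. increments \<delta> (sample_path B \<omega>)))
        {\<omega>\<in>space (\<Pi>\<^sub>M k\<in>UNIV. borel). x + walk \<omega> k \<in> C k}"
      by (simp add: distr_increments[OF B \<delta>] space_PiM)
    also have "\<dots> = emeasure M {\<omega>\<in>space M. x + walk (increments \<delta> (sample_path B \<omega>)) k \<in> C k}"
    proof -
      have "{\<omega>\<in>space (\<Pi>\<^sub>M k\<in>UNIV. borel). x + walk \<omega> k \<in> C k} \<in> sets (\<Pi>\<^sub>M k\<in>(UNIV::nat set). borel)"
        by measurable
      then show ?thesis
        by (subst emeasure_distr) (auto simp: space_PiM intro!: arg_cong[where f="emeasure M"])
    qed
    also have "\<dots> = emeasure M ((\<lambda>\<omega>. B (real k * \<delta>) \<omega> - B 0 \<omega>) -` {z. x + z \<in> C k} \<inter> space M)"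
      using \<delta> B0 by (intro arg_cong[where f="emeasure M"])
        (auto simp: walk_increments sample_path_def)
    also have "\<dots> = emeasure (distr M borel (\<lambda>\<omega>. B (real k * \<delta>) \<omega> - B 0 \<omega>)) {z. x + z \<in> C k}"
    proof -
      have "{z. x + z \<in> C k} \<in> sets borel"
        by measurable
      moreover have "(\<lambda>\<omega>. B (real k * \<delta>) \<omega> - B 0 \<omega>) \<in> borel_measurable M"
        using \<delta> by (intro borel_measurable_diff Bm) auto
      ultimately show ?thesis
        by (subst emeasure_distr) auto
    qed
    also have "\<dots> = emeasure (gauss_law (real k * \<delta>)) {z. x + z \<in> C k}"
      using \<delta> by (subst distr_increment[OF B]) auto
    finally show ?thesis .
  qed
  then show ?thesis
    by (simp add: G.occ_def)
qed

end

section \<open>Confinement to a box\<close>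

text \<open>Truncating the cosine matters: the plain product of cosines over the coordinates is positive
  again where two coordinates have both left the box.\<close>

definition bump :: "real \<Rightarrow> real \<Rightarrow> real" where
  "bump w x = (if \<bar>x\<bar> < w then cos (pi / (2 * w) * x) else 0)"

lemma bump_measurable [measurable]: "bump w \<in> borel_measurable borel"
  unfolding bump_def[abs_def] by measurable

lemma bump_nonneg: "0 \<le> bump w x"
proof (cases "\<bar>x\<bar> < w")
  case True
  then have "pi / (2 * w) * \<bar>x\<bar> \<le> pi / (2 * w) * w"
    by (intro mult_left_mono) auto
  also have "\<dots> = pi / 2"
    using True by simp
  finally have "\<bar>pi / (2 * w) * x\<bar> \<le> pi / 2"
    using True by (simp add: abs_mult)
  then have "- (pi / 2) \<le> pi / (2 * w) * x" "pi / (2 * w) * x \<le> pi / 2"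
    by linarith+
  then have "0 \<le> cos (pi / (2 * w) * x)"
    by (rule cos_ge_zero)
  then show ?thesis by (simp add: bump_def)
qed (simp add: bump_def)

lemma bump_le_1: "bump w x \<le> 1"
  by (simp add: bump_def)

text \<open>Up to \<open>\<bar>y + x\<bar> = 3 * w\<close> truncation only removes negative values
  of the cosine. Beyond that the jump satisfies \<open>\<bar>x\<bar> > 2 * w\<close>, so the
  subtracted power is at least \<open>1\<close>. The fourth power is chosen because its Gaussian
  mean is of order \<open>s\<^sup>2\<close>: summed over \<open>T / s\<close> steps the error is
  still of order \<open>s\<close>.\<close>

lemma bump_ge:
  assumes w: "0 < w" and y: "\<bar>y\<bar> < w"
  shows "cos (pi / (2 * w) * (y + x)) - (x / (2 * w)) ^ 4 \<le> bump w (y + x)"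
proof -
  have 4: "0 \<le> (x / (2 * w)) ^ 4" by simp
  consider "\<bar>y + x\<bar> < w" | "w \<le> \<bar>y + x\<bar>" "\<bar>y + x\<bar> \<le> 3 * w" | "3 * w < \<bar>y + x\<bar>"
    by linarith
  then show ?thesis
  proof cases
    case 1
    then show ?thesis using 4 by (simp add: bump_def)
  next
    case 2
    let ?u = "pi / (2 * w) * \<bar>y + x\<bar>"
    have "pi / 2 \<le> ?u" "?u \<le> 3 * pi / 2"
      using 2 w by (auto simp: field_simps)
    then have "0 \<le> cos (?u - pi)"
      by (intro cos_ge_zero) auto
    then have "cos ?u \<le> 0"
      by (simp add: cos_diff)
    moreover have "cos (pi / (2 * w) * (y + x)) = cos ?u"
      by (cases "0 \<le> y + x") (simp_all only: abs_of_nonneg abs_of_neg not_le mult_minus_right cos_minus)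
    ultimately show ?thesis using 4 bump_nonneg[of w "y + x"] by linarith
  next
    case 3
    then have "1 \<le> \<bar>x / (2 * w)\<bar>"
      using w y by (simp add: field_simps)
    then have "1 \<le> \<bar>x / (2 * w)\<bar> ^ 4"
      by (rule one_le_power)
    then have "1 \<le> (x / (2 * w)) ^ 4"
      by (simp only: power_even_abs even_numeral)
    moreover have "cos (pi / (2 * w) * (y + x)) \<le> 1"
      by simp
    ultimately show ?thesis
      using bump_nonneg[of w "y + x"] by linarith
  qed
qed

lemma normal_bump_ge:
  assumes w: "0 < w" and y: "\<bar>y\<bar> < w" and s: "0 < s"
  shows "exp (- ((pi / (2 * w))\<^sup>2 * s / 2)) * bump w y - 3 * s\<^sup>2 / (16 * w ^ 4) \<le>
    (\<integral>x. normal_density 0 (sqrt s) x * bump w (y + x) \<partial>lborel)"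
proof -
  let ?N = "normal_density 0 (sqrt s)"
  \<comment> \<open>The fourth moment of the centred normal law of variance \<open>s\<close>;
    dividing by \<open>(2 * w) ^ 4\<close> gives the error term.\<close>
  have "has_bochner_integral lborel (\<lambda>x. ?N x * x ^ 4) (3 * s\<^sup>2)"
    using normal_moment_even[of "sqrt s" 0 2] s
    by (simp add: fact_numeral power2_eq_square field_simps)
  from has_bochner_integral_divide[OF this, of "(2 * w) ^ 4"]
  have "has_bochner_integral lborel (\<lambda>x. ?N x * (x / (2 * w)) ^ 4) (3 * s\<^sup>2 / (16 * w ^ 4))"
    by (simp add: power_divide power_mult_distrib)
  then have m: "integrable lborel (\<lambda>x. ?N x * (x / (2 * w)) ^ 4)"
      "(\<integral>x. ?N x * (x / (2 * w)) ^ 4 \<partial>lborel) = 3 * s\<^sup>2 / (16 * w ^ 4)"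
    by (simp_all add: has_bochner_integral_iff)
  note c = normal_cos[OF s, of "pi / (2 * w)" y]
  have "exp (- ((pi / (2 * w))\<^sup>2 * s / 2)) * bump w y - 3 * s\<^sup>2 / (16 * w ^ 4) =
    (\<integral>x. ?N x * cos (pi / (2 * w) * (y + x)) - ?N x * (x / (2 * w)) ^ 4 \<partial>lborel)"
    by (subst Bochner_Integration.integral_diff[OF c(1) m(1)]) (simp only: c(2) m(2) bump_def y if_True)
  also have "\<dots> \<le> (\<integral>x. ?N x * bump w (y + x) \<partial>lborel)"
  proof (rule integral_mono)
    show "integrable lborel (\<lambda>x. ?N x * cos (pi / (2 * w) * (y + x)) - ?N x * (x / (2 * w)) ^ 4)"
      using c(1) m(1) by (rule Bochner_Integration.integrable_diff)
    show "integrable lborel (\<lambda>x. ?N x * bump w (y + x))"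
      using s by (rule integrable_normal_density_bounded) (auto simp: bump_nonneg bump_le_1)
    show "?N x * cos (pi / (2 * w) * (y + x)) - ?N x * (x / (2 * w)) ^ 4 \<le> ?N x * bump w (y + x)" for x
      using mult_left_mono[OF bump_ge[OF w y, of x], of "?N x"] by (simp add: right_diff_distrib)
  qed
  finally show ?thesis .
qed

text \<open>Exchanging the factors one at a time costs at most \<open>e\<close> each as long as all
  of them lie in the unit interval. \<open>A i\<close> may exceed \<open>1\<close>, so the exchange
  is made against \<open>min (A i) (B i)\<close>.\<close>

lemma prod_ge_prod_minus:
  fixes A B :: "'i \<Rightarrow> real" and e :: real
  assumes "finite I" "\<And>i. i \<in> I \<Longrightarrow> 0 \<le> A i" "\<And>i. i \<in> I \<Longrightarrow> 0 \<le> B i" "\<And>i. i \<in> I \<Longrightarrow> B i \<le> 1"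
    "\<And>i. i \<in> I \<Longrightarrow> B i - e \<le> A i" "0 \<le> e"
  shows "(\<Prod>i\<in>I. B i) - card I * e \<le> (\<Prod>i\<in>I. A i)"
proof -
  have "norm ((\<Prod>i\<in>I. min (A i) (B i)) - (\<Prod>i\<in>I. B i)) \<le> (\<Sum>i\<in>I. norm (min (A i) (B i) - B i))"
    using assms by (intro norm_prod_diff) (fastforce simp: min_def)+
  also have "\<dots> \<le> (\<Sum>i\<in>I. e)"
  proof (rule sum_mono)
    fix i assume "i \<in> I"
    then show "norm (min (A i) (B i) - B i) \<le> e"
      using assms(5)[of i] assms(6) by (auto simp: min_def)
  qed
  finally have "(\<Prod>i\<in>I. B i) - card I * e \<le> (\<Prod>i\<in>I. min (A i) (B i))"
    by simp
  also have "\<dots> \<le> (\<Prod>i\<in>I. A i)"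
    using assms by (intro prod_mono) auto
  finally show ?thesis .
qed

text \<open>A box rather than a disc, so that products of one-dimensional functions of the
  coordinates vanish outside it.\<close>

definition centred_box :: "real \<Rightarrow> 'a::euclidean_space set" where
  "centred_box w = {y. \<forall>b\<in>Basis. \<bar>y \<bullet> b\<bar> < w}"

lemma centred_box_measurable [measurable]: "centred_box w \<in> sets borel"
  unfolding centred_box_def by measurable

text \<open>For a fixed time span \<open>n * s\<close> the error term is linear in the time step \<open>s\<close>, so it disappears
  as the grid is refined.\<close>

lemma gauss_walk_stay:
  assumes w: "0 < w" and s: "0 < s"
  shows "random_walk.hit (gauss_law s) n (\<lambda>_. - centred_box w) (0 :: 'a::euclidean_space) \<le>
    ennreal (1 - exp (- (DIM('a) * (pi / (2 * w))\<^sup>2 * (n * s) / 2)) + n * (DIM('a) * (3 * s\<^sup>2 / (16 * w ^ 4))))"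
proof -
  interpret random_walk "gauss_law s :: 'a measure"
    using s by (intro random_walk_gauss_law) simp
  \<comment> \<open>The principal Dirichlet eigenvalue of half the Laplacian on an interval of
    half-width \<open>w\<close> is \<open>pi\<^sup>2 / (8 * w\<^sup>2)\<close>; \<open>q\<close> is
    the decay it causes in one coordinate during time \<open>s\<close>.\<close>
  define q where "q = exp (- ((pi / (2 * w))\<^sup>2 * s / 2))"
  define e where "e = 3 * s\<^sup>2 / (16 * w ^ 4)"
  define \<phi> :: "'a \<Rightarrow> real" where "\<phi> = (\<lambda>y. \<Prod>b\<in>Basis. bump w (y \<bullet> b))"
  have q: "0 \<le> q" "q \<le> 1"
    using s by (auto simp: q_def)
  have e: "0 \<le> e"
    by (simp add: e_def)
  have "hit n (\<lambda>_. - centred_box w) 0 \<le> ennreal (1 - (q ^ DIM('a)) ^ n * \<phi> 0 + n * (DIM('a) * e))"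
  proof (rule hit_complement_le)
    show "\<phi> \<in> borel_measurable borel"
      unfolding \<phi>_def by measurable
    show "\<phi> y \<le> 0" if "y \<notin> centred_box w" for y
    proof -
      from that obtain b where "b \<in> Basis" "bump w (y \<bullet> b) = 0"
        by (auto simp: centred_box_def bump_def)
      then have "\<phi> y = 0"
        unfolding \<phi>_def by (intro prod_zero) auto
      then show ?thesis by simp
    qed
    show "\<bar>\<phi> y\<bar> \<le> 1" for y
      using prod_nonneg[of Basis "\<lambda>b. bump w (y \<bullet> b)"] prod_le_1[of Basis "\<lambda>b. bump w (y \<bullet> b)"]
      by (simp add: \<phi>_def bump_nonneg bump_le_1)
    show "q ^ DIM('a) * \<phi> y - DIM('a) * e \<le> (\<integral>z. \<phi> (y + z) \<partial>gauss_law s)" if "y \<in> centred_box w" for y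
    proof -
      have "q ^ DIM('a) * \<phi> y - DIM('a) * e = (\<Prod>b\<in>Basis. q * bump w (y \<bullet> b)) - DIM('a) * e"
        by (simp add: \<phi>_def prod.distrib)
      also have "\<dots> \<le> (\<Prod>b\<in>Basis. \<integral>x. normal_density 0 (sqrt s) x * bump w (y \<bullet> b + x) \<partial>lborel)"
      proof (rule prod_ge_prod_minus)
        show "q * bump w (y \<bullet> b) - e \<le> (\<integral>x. normal_density 0 (sqrt s) x * bump w (y \<bullet> b + x) \<partial>lborel)"
          if "b \<in> Basis" for b
          using that \<open>y \<in> centred_box w\<close> normal_bump_ge[OF w _ s, of "y \<bullet> b"]
          by (simp add: centred_box_def q_def e_def)
      qed (auto simp: bump_nonneg e q intro!: integral_nonneg_AE mult_le_one bump_le_1)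
      also have "\<dots> = (\<integral>z. \<phi> (y + z) \<partial>gauss_law s)"
        unfolding \<phi>_def inner_add_left
        by (rule integral_gauss_law_prod[symmetric, OF s])
          (auto intro!: integrable_normal_density_bounded s simp: bump_nonneg bump_le_1)
      finally show ?thesis .
    qed
  qed (auto simp: q e power_le_one)
  moreover have "(q ^ DIM('a)) ^ n = exp (- (DIM('a) * (pi / (2 * w))\<^sup>2 * (n * s) / 2))"
    by (simp add: q_def exp_of_nat_mult[symmetric] algebra_simps)
  moreover have "\<phi> 0 = 1"
    using w by (simp add: \<phi>_def bump_def)
  ultimately show ?thesis
    by (simp add: e_def)
qed

section \<open>Volume of the sausage in the plane\<close>

lemma emeasure_lborel_translate:
  fixes A :: "'a::euclidean_space set"
  assumes [measurable]: "A \<in> sets borel"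
  shows "emeasure lborel {z. x + z \<in> A} = emeasure lborel A"
proof -
  have "emeasure lborel A = emeasure (distr lborel borel ((+) x)) A"
    by (simp add: lborel_distr_plus)
  also have "\<dots> = emeasure lborel {z. x + z \<in> A}"
    by (subst emeasure_distr) (auto simp: vimage_def)
  finally show ?thesis ..
qed

lemma emeasure_ball_plane:
  fixes x :: "real ^ 2"
  assumes "0 \<le> r"
  shows "emeasure lborel (ball x r) = ennreal (pi * r\<^sup>2)"
    and "emeasure lborel (cball x r) = ennreal (pi * r\<^sup>2)"
  using assms by (simp_all add: emeasure_ball emeasure_cball unit_ball_vol_2)

text \<open>Telescoping of \<open>ln (1 + 1 / m) \<le> 1 / m\<close>.\<close>

lemma ln_quotient_le_sum_inverse:
  assumes "1 \<le> k0" "k0 \<le> Suc u"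
  shows "ln (real (Suc u) / real k0) \<le> (\<Sum>k=k0..u. 1 / real k)"
proof -
  have "ln (real m / real k0) \<le> (\<Sum>k\<in>{k0..<m}. 1 / real k)" if "k0 \<le> m" for m
    using that
  proof (induction m rule: dec_induct)
    case base
    then show ?case using assms(1) by simp
  next
    case (step m)
    have "0 < m" using step.hyps assms(1) by simp
    then have "real (Suc m) / real k0 = real m / real k0 * (1 + 1 / real m)"
      using assms(1) by (simp add: field_simps)
    then have "ln (real (Suc m) / real k0) = ln (real m / real k0) + ln (1 + 1 / real m)"
      using assms(1) \<open>0 < m\<close> by (simp only:) (rule ln_mult_pos; simp add: add_pos_nonneg)
    also have "\<dots> \<le> (\<Sum>k\<in>{k0..<m}. 1 / real k) + 1 / real m"
      by (intro add_mono step.IH ln_add_one_self_le_self) auto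
    finally show ?case
      using step.hyps by simp
  qed
  from this[OF assms(2)] show ?thesis
    by (simp add: atLeastLessThanSuc_atLeastAtMost)
qed

context prob_space
begin

context
  fixes B :: "real \<Rightarrow> 'a \<Rightarrow> real ^ 2"
  assumes B: "standard_brownian_motion M B"
begin

text \<open>Area \<open>pi * r\<^sup>2\<close> times peak density gives
  \<open>r\<^sup>2 / (2 * k)\<close> at step \<open>k\<close>. Time \<open>0\<close>, where there is
  no density, contributes at most the leading \<open>1\<close>. The bound is uniform in
  \<open>y\<close> and in the positions of the sets, which is what makes an arbitrary target path
  harmless.\<close>

lemma plane_occ_le:
  fixes y :: "real ^ 2"
  assumes [measurable]: "\<And>k. C k \<in> sets borel"
    and vol: "\<And>k. emeasure lborel (C k) \<le> ennreal (pi * r\<^sup>2)"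
  shows "random_walk.occ (gauss_law 1) n C y \<le> ennreal (1 + r\<^sup>2 / 2 * harm n)"
proof -
  have summand: "emeasure (gauss_law (real (Suc k))) {z. y + z \<in> C (Suc k)} \<le> ennreal (r\<^sup>2 / 2 * inverse (real (Suc k)))" for k
  proof -
    have "emeasure (gauss_law (real (Suc k))) {z. y + z \<in> C (Suc k)} \<le>
        ennreal (1 / (2 * pi * real (Suc k))) * emeasure lborel {z. y + z \<in> C (Suc k)}"
      by (rule emeasure_gauss_law_plane_le) auto
    also have "\<dots> \<le> ennreal (1 / (2 * pi * real (Suc k))) * ennreal (pi * r\<^sup>2)"
      by (intro mult_left_mono) (simp_all add: emeasure_lborel_translate vol)
    also have "\<dots> = ennreal (r\<^sup>2 / 2 * inverse (real (Suc k)))"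
      by (subst ennreal_mult'[symmetric]) (auto simp: field_simps simp del: of_nat_Suc)
    finally show ?thesis .
  qed
  have "random_walk.occ (gauss_law 1) n C y = (\<Sum>k\<le>n. emeasure (gauss_law (real k)) {z. y + z \<in> C k})"
    using grid_occ[OF B, of 1 C n y] by simp
  also have "\<dots> = emeasure (gauss_law 0) {z. y + z \<in> C 0} +
      (\<Sum>k<n. emeasure (gauss_law (real (Suc k))) {z. y + z \<in> C (Suc k)})"
    by (subst sum.atMost_shift) simp
  also have "\<dots> \<le> 1 + (\<Sum>k<n. ennreal (r\<^sup>2 / 2 * inverse (real (Suc k))))"
    by (intro add_mono sum_mono summand prob_space.emeasure_le_1 prob_space_gauss_law) simp
  also have "\<dots> = ennreal (1 + (\<Sum>k<n. r\<^sup>2 / 2 * inverse (real (Suc k))))"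
  proof -
    have "0 \<le> (\<Sum>k<n. r\<^sup>2 / 2 * inverse (real (Suc k)))"
      by (intro sum_nonneg) auto
    then show ?thesis
      by (subst sum_ennreal) auto
  qed
  also have "(\<Sum>k<n. r\<^sup>2 / 2 * inverse (real (Suc k))) = r\<^sup>2 / 2 * harm n"
    by (simp add: harm_def sum_distrib_left sum.atLeast1_atMost_eq)
  finally show ?thesis .
qed

text \<open>The total occupation of \<open>Suc n\<close> sets of equal area is divided by the
  largest expected number of visits after an entrance. Monotonicity of \<open>harm\<close> lets the
  constant for \<open>n\<close> serve every shorter remaining time.\<close>

lemma plane_hit_ge:
  fixes C :: "nat \<Rightarrow> (real ^ 2) set"
  assumes [measurable]: "\<And>k. C k \<in> sets borel"
    and vol: "\<And>k. emeasure lborel (C k) = ennreal (pi * r\<^sup>2)"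
  shows "ennreal (pi * r\<^sup>2 * real (Suc n) / (1 + r\<^sup>2 / 2 * harm n)) \<le>
    (\<integral>\<^sup>+x. random_walk.hit (gauss_law 1) n C x \<partial>lborel)"
proof -
  interpret G: random_walk "gauss_law 1 :: (real ^ 2) measure"
    by (rule random_walk_gauss_law) simp
  define K where "K = 1 + r\<^sup>2 / 2 * harm n"
  have K: "0 < K"
    unfolding K_def by (intro add_pos_nonneg mult_nonneg_nonneg harm_nonneg) auto
  have le: "G.occ n C x \<le> ennreal K * G.hit n C x" for x
  proof (rule G.occ_le_hit)
    fix j m :: nat and y :: "real ^ 2" assume "j + m \<le> n"
    have "G.occ m (\<lambda>k. C (j + k)) y \<le> ennreal (1 + r\<^sup>2 / 2 * harm m)"
      by (rule plane_occ_le) (auto simp: vol)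
    also have "\<dots> \<le> ennreal K"
      unfolding K_def using \<open>j + m \<le> n\<close> by (intro ennreal_leI add_left_mono mult_left_mono harm_mono) auto
    finally show "G.occ m (\<lambda>k. C (j + k)) y \<le> ennreal K" .
  qed simp
  have "ennreal (pi * r\<^sup>2 * real (Suc n) / K) = ennreal (1 / K) * (\<Sum>k\<le>n. emeasure lborel (C k))"
    using K by (simp add: vol ennreal_of_nat_eq_real_of_nat ennreal_mult[symmetric] field_simps del: of_nat_Suc)
  also have "\<dots> = ennreal (1 / K) * (\<integral>\<^sup>+x. G.occ n C x \<partial>lborel)"
    by (subst G.nn_integral_occ) auto
  also have "\<dots> \<le> ennreal (1 / K) * (\<integral>\<^sup>+x. ennreal K * G.hit n C x \<partial>lborel)"
    by (intro mult_left_mono nn_integral_mono le) auto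
  also have "\<dots> = (\<integral>\<^sup>+x. G.hit n C x \<partial>lborel)"
    using K by (subst nn_integral_cmult) (auto simp: mult.assoc[symmetric] ennreal_mult[symmetric])
  finally show ?thesis
    by (simp add: K_def)
qed

text \<open>Two points of the disc are less than \<open>2 * \<rho>\<close> apart, so from time
  \<open>\<rho>\<^sup>2 * l\<close> on the Gaussian exponent is at most \<open>2 / l\<close> and the
  density is its peak value up to \<open>exp (- (2 / l))\<close>. Only the steps from
  \<open>k0\<close> on, which lie after that time, are counted; their harmonic sum gives the
  logarithm.\<close>

lemma plane_occ_ge:
  fixes y :: "real ^ 2"
  assumes "0 < \<delta>" "0 < \<rho>" "0 < l" "y \<in> ball 0 \<rho>" "1 \<le> k0" "k0 \<le> Suc u" "\<rho>\<^sup>2 * l \<le> real k0 * \<delta>"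
  shows "ennreal (exp (- (2 / l)) * (\<rho>\<^sup>2 / (2 * \<delta>)) * ln (real (Suc u) / real k0)) \<le>
    random_walk.occ (gauss_law \<delta>) u (\<lambda>_. ball 0 \<rho>) y"
proof -
  have summand: "ennreal (exp (- (2 / l)) * (\<rho>\<^sup>2 / (2 * \<delta>)) * (1 / real k)) \<le>
      emeasure (gauss_law (real k * \<delta>)) {z. y + z \<in> ball 0 \<rho>}" if "k0 \<le> k" for k
  proof -
    have k: "0 < real k * \<delta>"
      using assms that by simp
    have "real k0 * \<delta> \<le> real k * \<delta>"
      using that assms by (intro mult_right_mono) auto
    with assms have "\<rho>\<^sup>2 * l \<le> real k * \<delta>"
      by linarith
    then have "(2 * \<rho>)\<^sup>2 / (2 * (real k * \<delta>)) \<le> 2 / l"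
      using k assms(3) by (simp add: field_simps power2_eq_square)
    then have "exp (- (2 / l)) \<le> exp (- ((2 * \<rho>)\<^sup>2 / (2 * (real k * \<delta>))))"
      by simp
    then have "exp (- (2 / l)) * (\<rho>\<^sup>2 / (2 * (real k * \<delta>))) \<le>
        exp (- ((2 * \<rho>)\<^sup>2 / (2 * (real k * \<delta>)))) * (\<rho>\<^sup>2 / (2 * (real k * \<delta>)))"
      using k by (intro mult_right_mono) auto
    then have "ennreal (exp (- (2 / l)) * (\<rho>\<^sup>2 / (2 * \<delta>)) * (1 / real k)) \<le>
      ennreal (exp (- ((2 * \<rho>)\<^sup>2 / (2 * (real k * \<delta>)))) / (2 * pi * (real k * \<delta>)) * (pi * \<rho>\<^sup>2))"
      by (intro ennreal_leI) (simp add: field_simps)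
    also have "\<dots> = ennreal (exp (- ((2 * \<rho>)\<^sup>2 / (2 * (real k * \<delta>)))) / (2 * pi * (real k * \<delta>))) *
        emeasure lborel {z. y + z \<in> ball 0 \<rho>}"
    proof -
      have "emeasure lborel {z. y + z \<in> ball 0 \<rho>} = ennreal (pi * \<rho>\<^sup>2)"
        using assms(2) by (subst emeasure_lborel_translate) (auto simp: emeasure_ball_plane)
      then show ?thesis
        using k by (simp only:) (rule ennreal_mult; simp)
    qed
    also have "\<dots> \<le> emeasure (gauss_law (real k * \<delta>)) {z. y + z \<in> ball 0 \<rho>}"
    proof (rule emeasure_gauss_law_plane_ge[OF k])
      have [measurable]: "ball (0 :: real ^ 2) \<rho> \<in> sets borel"
        by simp
      show "{z. y + z \<in> ball 0 \<rho>} \<in> sets borel"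
        by measurable
      show "norm z \<le> 2 * \<rho>" if "z \<in> {z. y + z \<in> ball 0 \<rho>}" for z
        using that assms(4) norm_triangle_ineq4[of "y + z" y] unfolding mem_Collect_eq mem_ball_0 by simp
    qed
    finally show ?thesis .
  qed
  have "ennreal (exp (- (2 / l)) * (\<rho>\<^sup>2 / (2 * \<delta>)) * ln (real (Suc u) / real k0)) \<le>
    ennreal (exp (- (2 / l)) * (\<rho>\<^sup>2 / (2 * \<delta>)) * (\<Sum>k=k0..u. 1 / real k))"
    using assms by (intro ennreal_leI mult_left_mono ln_quotient_le_sum_inverse) auto
  also have "\<dots> = (\<Sum>k=k0..u. ennreal (exp (- (2 / l)) * (\<rho>\<^sup>2 / (2 * \<delta>)) * (1 / real k)))"
    using assms(1) by (subst sum_ennreal) (auto simp: sum_distrib_left)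
  also have "\<dots> \<le> (\<Sum>k=k0..u. emeasure (gauss_law (real k * \<delta>)) {z. y + z \<in> ball 0 \<rho>})"
    by (intro sum_mono summand) auto
  also have "\<dots> \<le> (\<Sum>k\<le>u. emeasure (gauss_law (real k * \<delta>)) {z. y + z \<in> ball 0 \<rho>})"
    by (intro sum_mono2) auto
  also have "\<dots> = random_walk.occ (gauss_law \<delta>) u (\<lambda>_. ball 0 \<rho>) y"
    using assms(1) by (intro grid_occ[OF B, symmetric]) auto
  finally show ?thesis .
qed

text \<open>The occupation over \<open>Suc (n + u)\<close> times divided by the visits guaranteed
  within \<open>u\<close> steps. Both are proportional to \<open>\<rho>\<^sup>2\<close>, so the
  radius survives only through the condition on \<open>k0\<close>. Strictness of
  \<open>k0 < Suc u\<close> keeps the divisor positive.\<close>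

lemma plane_hit_le:
  assumes "0 < \<delta>" "0 < \<rho>" "0 < l" "1 \<le> k0" "k0 < Suc u" "\<rho>\<^sup>2 * l \<le> real k0 * \<delta>"
  shows "(\<integral>\<^sup>+x. random_walk.hit (gauss_law \<delta>) n (\<lambda>_. ball (0 :: real ^ 2) \<rho>) x \<partial>lborel) \<le>
    ennreal (2 * pi * (real (Suc (n + u)) * \<delta>) * exp (2 / l) / ln (real (Suc u) / real k0))"
proof -
  interpret G: random_walk "gauss_law \<delta> :: (real ^ 2) measure"
    using assms(1) by (intro random_walk_gauss_law) simp
  define c where "c = exp (- (2 / l)) * (\<rho>\<^sup>2 / (2 * \<delta>)) * ln (real (Suc u) / real k0)"
  have c: "0 < c"
    using assms by (auto simp: c_def ln_gt_zero_iff)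
  have le: "ennreal c * G.hit n (\<lambda>_. ball 0 \<rho>) x \<le> G.occ (n + u) (\<lambda>_. ball 0 \<rho>) x" for x
    using assms unfolding c_def by (intro G.hit_le_occ_later plane_occ_ge) auto
  have "(\<integral>\<^sup>+x. G.hit n (\<lambda>_. ball 0 \<rho>) x \<partial>lborel) =
      ennreal (1 / c) * (\<integral>\<^sup>+x. ennreal c * G.hit n (\<lambda>_. ball 0 \<rho>) x \<partial>lborel)"
    using c by (subst nn_integral_cmult) (auto simp: mult.assoc[symmetric] ennreal_mult[symmetric])
  also have "\<dots> \<le> ennreal (1 / c) * (\<integral>\<^sup>+x. G.occ (n + u) (\<lambda>_. ball 0 \<rho>) x \<partial>lborel)"
    by (intro mult_left_mono nn_integral_mono le) auto
  also have "\<dots> = ennreal (1 / c) * ennreal (real (Suc (n + u)) * (pi * \<rho>\<^sup>2))"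
    using assms(2) by (subst G.nn_integral_occ)
      (auto simp: emeasure_ball_plane ennreal_of_nat_eq_real_of_nat ennreal_mult'
        simp del: of_nat_Suc)
  also have "\<dots> = ennreal (2 * pi * (real (Suc (n + u)) * \<delta>) * exp (2 / l) / ln (real (Suc u) / real k0))"
    using assms c
    by (subst ennreal_mult'[symmetric]) (auto simp: c_def exp_minus field_simps power2_eq_square simp del: of_nat_Suc)
  finally show ?thesis .
qed

end

end

section \<open>The Laplace functional of a Poisson process\<close>

context prob_space
begin

text \<open>The probability generating function, by the exponential series. The boundary cases
  \<open>s = 0\<close> and \<open>\<mu> = 0\<close> are included through
  \<open>0 ^ 0 = 1\<close>.\<close>

lemma poisson_pgf:
  assumes N: "N \<in> measurable M (count_space UNIV)" and \<mu>: "0 \<le> \<mu>" and s: "0 \<le> s" "s \<le> 1"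
    and law: "\<And>k. prob {\<omega>\<in>space M. N \<omega> = k} = exp (- \<mu>) * \<mu> ^ k / fact k"
  shows "expectation (\<lambda>\<omega>. s ^ N \<omega>) = exp (- (\<mu> * (1 - s)))"
proof -
  note N [measurable]
  have "(\<integral>\<^sup>+\<omega>. ennreal (s ^ N \<omega>) \<partial>M) = (\<integral>\<^sup>+\<omega>. (\<Sum>k. ennreal (s ^ k) * indicator {\<omega>\<in>space M. N \<omega> = k} \<omega>) \<partial>M)"
  proof (rule nn_integral_cong)
    fix \<omega> assume "\<omega> \<in> space M"
    then have "(\<lambda>k. ennreal (s ^ k) * indicator {\<omega>\<in>space M. N \<omega> = k} \<omega>) = (\<lambda>k. if k = N \<omega> then ennreal (s ^ k) else 0)"
      by (auto simp: fun_eq_iff)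
    then show "ennreal (s ^ N \<omega>) = (\<Sum>k. ennreal (s ^ k) * indicator {\<omega>\<in>space M. N \<omega> = k} \<omega>)"
      using sums_single[of "N \<omega>" "\<lambda>k. ennreal (s ^ k)"] by (simp add: sums_iff)
  qed
  also have "\<dots> = (\<Sum>k. \<integral>\<^sup>+\<omega>. ennreal (s ^ k) * indicator {\<omega>\<in>space M. N \<omega> = k} \<omega> \<partial>M)"
    by (rule nn_integral_suminf) measurable
  also have "\<dots> = (\<Sum>k. ennreal (exp (- \<mu>) * ((s * \<mu>) ^ k / fact k)))"
  proof (rule suminf_cong)
    fix k
    have "{\<omega>\<in>space M. N \<omega> = k} \<in> events"
      by measurable
    then have "(\<integral>\<^sup>+\<omega>. ennreal (s ^ k) * indicator {\<omega>\<in>space M. N \<omega> = k} \<omega> \<partial>M) = ennreal (s ^ k) * ennreal (exp (- \<mu>) * \<mu> ^ k / fact k)"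
      by (subst nn_integral_cmult_indicator) (auto simp: emeasure_eq_measure law)
    also have "\<dots> = ennreal (exp (- \<mu>) * ((s * \<mu>) ^ k / fact k))"
      using s \<mu> by (subst ennreal_mult[symmetric]) (auto simp: power_mult_distrib mult_ac)
    finally show "(\<integral>\<^sup>+\<omega>. ennreal (s ^ k) * indicator {\<omega>\<in>space M. N \<omega> = k} \<omega> \<partial>M) = ennreal (exp (- \<mu>) * ((s * \<mu>) ^ k / fact k))" .
  qed
  also have "\<dots> = ennreal (exp (- (\<mu> * (1 - s))))"
  proof -
    have "(\<lambda>k. (s * \<mu>) ^ k / fact k) sums exp (s * \<mu>)"
      using exp_converges[of "s * \<mu>"] by (simp add: scaleR_conv_of_real divide_inverse mult.commute)
    then have "(\<lambda>k. exp (- \<mu>) * ((s * \<mu>) ^ k / fact k)) sums (exp (- \<mu>) * exp (s * \<mu>))"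
      by (rule sums_mult)
    moreover have "exp (- \<mu>) * exp (s * \<mu>) = exp (- (\<mu> * (1 - s)))"
      by (simp add: exp_add[symmetric] algebra_simps)
    ultimately show ?thesis
      using s \<mu> by (intro suminf_ennreal_eq) auto
  qed
  finally have "(\<integral>\<^sup>+\<omega>. ennreal (s ^ N \<omega>) \<partial>M) = ennreal (exp (- (\<mu> * (1 - s))))" .
  moreover have "(\<lambda>\<omega>. s ^ N \<omega>) \<in> borel_measurable M"
    by (rule measurable_compose[OF N]) simp
  ultimately show ?thesis
    using s by (subst integral_eq_nn_integral) auto
qed

context
  fixes X :: "nat \<Rightarrow> 'a \<Rightarrow> 'b::euclidean_space" and lam :: real
  assumes lam: "0 \<le> lam" and ppp: "poisson_point_process M lam X"
begin

lemma point_measurable [measurable]: "X i \<in> borel_measurable M"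
  using ppp by (simp add: poisson_point_process_def)

lemma point_prod_antimono:
  fixes p :: "'b \<Rightarrow> real"
  assumes "\<And>x. 0 \<le> p x" "\<And>x. p x \<le> 1" "m \<le> n"
  shows "(\<Prod>i<n. 1 - p (X i \<omega>)) \<le> (\<Prod>i<m. 1 - p (X i \<omega>))"
  using assms(3)
proof (induction n rule: dec_induct)
  case (step n)
  have "(\<Prod>i<n. 1 - p (X i \<omega>)) * (1 - p (X n \<omega>)) \<le> (\<Prod>i<n. 1 - p (X i \<omega>)) * 1"
    using assms by (intro mult_left_mono prod_nonneg) (auto simp: algebra_simps)
  with step show ?case by simp
qed simp

lemma point_prod_bounds:
  fixes p :: "'b \<Rightarrow> real"
  assumes "\<And>x. 0 \<le> p x" "\<And>x. p x \<le> 1"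
  shows "0 \<le> (\<Prod>i<n. 1 - p (X i \<omega>))" "(\<Prod>i<n. 1 - p (X i \<omega>)) \<le> 1"
  using assms by (auto intro!: prod_nonneg prod_le_1)

lemma point_prod_integrable:
  fixes p :: "'b \<Rightarrow> real"
  assumes [measurable]: "p \<in> borel_measurable borel" and "\<And>x. 0 \<le> p x" "\<And>x. p x \<le> 1"
  shows "integrable M (\<lambda>\<omega>. \<Prod>i<n. 1 - p (X i \<omega>))"
  using point_prod_bounds[of p, OF assms(2,3)]
  by (intro integrable_const_bound[where B=1]) auto

text \<open>The nonzero level sets of \<open>q\<close> are disjoint and of finite volume, so their
  point counts are independent Poisson variables. Almost surely only finitely many points lie in the
  support, hence the partial products are eventually constant and equal to a finite product over
  level sets, whatever the enumeration.\<close>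

lemma laplace_functional_simple:
  fixes q :: "'b \<Rightarrow> real"
  assumes [measurable]: "q \<in> borel_measurable borel" and q: "\<And>x. 0 \<le> q x" "\<And>x. q x \<le> 1"
    and ran: "finite (range q)" and supp: "emeasure lborel {x. q x \<noteq> 0} < \<infinity>"
  shows "(\<lambda>m. expectation (\<lambda>\<omega>. \<Prod>i<m. 1 - q (X i \<omega>))) \<longlonglongrightarrow> exp (- (lam * (\<integral>x. q x \<partial>lborel)))"
proof -
  define F where "F = (\<lambda>a. q -` {a}) ` (range q - {0})"
  \<comment> \<open>For a level set this is the value of \<open>q\<close> on it. For any other
    \<open>A\<close> it is still some value of \<open>q\<close>, so the bounds by \<open>0\<close>
    and \<open>1\<close> hold for all \<open>A\<close>.\<close>
  define val where "val A = q (SOME x. x \<in> A)" for A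
  have F: "finite F" "disjoint F"
    using ran by (auto simp: F_def disjoint_def)
  have val: "val A = q x" if "A \<in> F" "x \<in> A" for A x
    using that someI[of "\<lambda>x. x \<in> A" x] by (auto simp: F_def val_def)
  have F_sets [measurable]: "A \<in> sets borel" if "A \<in> F" for A
    using that measurable_sets[OF assms(1), of "{_}"] by (auto simp: F_def)
  have F_supp: "\<Union>F = {x. q x \<noteq> 0}"
    by (auto simp: F_def)
  have F_fin: "emeasure lborel A < \<infinity>" if "A \<in> F" for A
  proof -
    have "emeasure lborel A \<le> emeasure lborel {x. q x \<noteq> 0}"
      using that F_supp by (intro emeasure_mono) auto
    then show ?thesis using supp by (rule le_less_trans)
  qed
  have val01: "0 \<le> val A" "val A \<le> 1" for A
    by (auto simp: val_def q)
  define Q where "Q \<omega> = (\<Prod>A\<in>F. (1 - val A) ^ point_count X A \<omega>)" for \<omega>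
  have indep: "indep_vars (\<lambda>_. count_space UNIV) (point_count X) F"
    using ppp F F_sets F_fin unfolding poisson_point_process_def by blast
  have N: "point_count X A \<in> measurable M (count_space UNIV)" if "A \<in> F" for A
    using indep that by (simp add: indep_vars_def)
  have Q_measurable [measurable]: "Q \<in> borel_measurable M"
    unfolding Q_def by (intro borel_measurable_prod measurable_compose[OF N]) auto
  have "expectation Q = (\<Prod>A\<in>F. expectation (\<lambda>\<omega>. (1 - val A) ^ point_count X A \<omega>))"
    unfolding Q_def
  proof (rule indep_vars_lebesgue_integral)
    show "indep_vars (\<lambda>_. borel) (\<lambda>A \<omega>. (1 - val A) ^ point_count X A \<omega>) F"
      by (rule indep_vars_compose2[OF indep]) simp
    show "integrable M (\<lambda>\<omega>. (1 - val A) ^ point_count X A \<omega>)" if "A \<in> F" for A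
    proof (rule integrable_const_bound[where B=1])
      show "(\<lambda>\<omega>. (1 - val A) ^ point_count X A \<omega>) \<in> borel_measurable M"
        using that by (intro measurable_compose[OF N]) auto
    qed (use val01 in \<open>auto intro!: power_le_one\<close>)
  qed (rule F)
  also have "\<dots> = (\<Prod>A\<in>F. exp (- (lam * measure lborel A * val A)))"
  proof (rule prod.cong[OF refl])
    fix A assume "A \<in> F"
    have "expectation (\<lambda>\<omega>. (1 - val A) ^ point_count X A \<omega>) = exp (- (lam * measure lborel A * (1 - (1 - val A))))"
    proof (rule poisson_pgf)
      show "prob {\<omega>\<in>space M. point_count X A \<omega> = k} =
          exp (- (lam * measure lborel A)) * (lam * measure lborel A) ^ k / fact k" for k
        using ppp F_sets[OF \<open>A \<in> F\<close>] F_fin[OF \<open>A \<in> F\<close>] unfolding poisson_point_process_def by blast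
    qed (use \<open>A \<in> F\<close> N val01 lam in auto)
    then show "expectation (\<lambda>\<omega>. (1 - val A) ^ point_count X A \<omega>) = exp (- (lam * measure lborel A * val A))"
      by simp
  qed
  also have "\<dots> = exp (- (lam * (\<integral>x. q x \<partial>lborel)))"
  proof -
    have q_eq: "q x = (\<Sum>A\<in>F. val A * indicator A x)" for x
    proof (cases "q x = 0")
      case True
      then have "x \<notin> A" if "A \<in> F" for A using that F_supp by auto
      then show ?thesis using True by simp
    next
      case False
      then obtain A where A: "A \<in> F" "x \<in> A" using F_supp by auto
      have "x \<in> A' \<longleftrightarrow> A' = A" if "A' \<in> F" for A'
        using that A F(2) unfolding disjoint_def by blast
      then have "(\<Sum>A'\<in>F. val A' * indicator A' x) = (\<Sum>A'\<in>F. if A' = A then val A else 0)"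
        by (intro sum.cong) (auto simp: indicator_def)
      also have "\<dots> = q x"
        using A F(1) val[of A x] by simp
      finally show ?thesis ..
    qed
    have "(\<integral>x. q x \<partial>lborel) = (\<integral>x. (\<Sum>A\<in>F. val A * indicator A x) \<partial>lborel)"
      by (simp only: q_eq[symmetric])
    also have "\<dots> = (\<Sum>A\<in>F. \<integral>x. val A * indicator A x \<partial>lborel)"
      using F_sets F_fin by (intro Bochner_Integration.integral_sum integrable_mult_right) (auto intro!: integrable_real_indicator)
    also have "\<dots> = (\<Sum>A\<in>F. val A * measure lborel A)"
      by (intro sum.cong) auto
    finally show ?thesis
      by (simp add: exp_sum[OF F(1), symmetric] sum_negf sum_distrib_left mult_ac)
  qed
  finally have EQ: "expectation Q = exp (- (lam * (\<integral>x. q x \<partial>lborel)))" .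
  have lim: "AE \<omega> in M. (\<lambda>m. \<Prod>i<m. 1 - q (X i \<omega>)) \<longlonglongrightarrow> Q \<omega>"
  proof -
    have "AE \<omega> in M. \<forall>A\<in>F. finite {i. X i \<omega> \<in> A}"
      using ppp F(1) F_sets F_fin unfolding poisson_point_process_def
      by (intro AE_finite_allI) blast+
    then show ?thesis
    proof (rule AE_mp, intro AE_I2 impI)
      fix \<omega> assume fin: "\<forall>A\<in>F. finite {i. X i \<omega> \<in> A}"
      define J where "J = (\<Union>A\<in>F. {i. X i \<omega> \<in> A})"
      have "finite J" using fin F(1) by (simp add: J_def)
      have "(\<Prod>i\<in>J. 1 - q (X i \<omega>)) = (\<Prod>A\<in>F. \<Prod>i\<in>{i. X i \<omega> \<in> A}. 1 - q (X i \<omega>))"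
        unfolding J_def using F fin by (intro prod.UNION_disjoint) (auto simp: disjoint_def)
      also have "\<dots> = (\<Prod>A\<in>F. \<Prod>i\<in>{i. X i \<omega> \<in> A}. 1 - val A)"
        by (intro prod.cong refl) (simp add: val)
      also have "\<dots> = Q \<omega>"
        by (simp add: Q_def point_count_def)
      finally have J: "(\<Prod>i\<in>J. 1 - q (X i \<omega>)) = Q \<omega>" .
      obtain m0 where m0: "J \<subseteq> {..<m0}"
        using \<open>finite J\<close> finite_nat_iff_bounded by blast
      have "(\<Prod>i<m. 1 - q (X i \<omega>)) = Q \<omega>" if "m0 \<le> m" for m
        unfolding J[symmetric]
      proof (rule prod.mono_neutral_right)
        show "J \<subseteq> {..<m}" using m0 that by auto
        show "\<forall>i\<in>{..<m} - J. 1 - q (X i \<omega>) = 1"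
        proof
          fix i assume "i \<in> {..<m} - J"
          then have "X i \<omega> \<notin> \<Union>F" by (auto simp: J_def)
          then show "1 - q (X i \<omega>) = 1" using F_supp by auto
        qed
      qed simp
      then have "\<forall>\<^sub>F m in sequentially. (\<Prod>i<m. 1 - q (X i \<omega>)) = Q \<omega>"
        by (auto simp: eventually_sequentially)
      then show "(\<lambda>m. \<Prod>i<m. 1 - q (X i \<omega>)) \<longlonglongrightarrow> Q \<omega>"
        by (rule tendsto_eventually)
    qed
  qed
  have "(\<lambda>m. expectation (\<lambda>\<omega>. \<Prod>i<m. 1 - q (X i \<omega>))) \<longlonglongrightarrow> expectation Q"
    using point_prod_bounds[of q, OF q]
    by (intro integral_dominated_convergence[where w="\<lambda>_. 1"] lim) auto
  then show ?thesis
    by (simp add: EQ)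
qed

text \<open>Simple functions \<open>q l\<close> increase to \<open>p\<close>, but the limits in
  \<open>l\<close> and \<open>m\<close> do not commute for free. Monotonicity in both arguments
  provides the two inequalities: the expectations decrease in \<open>m\<close> and decrease when the
  function grows.\<close>

lemma laplace_functional:
  fixes p :: "'b \<Rightarrow> real"
  assumes [measurable]: "p \<in> borel_measurable borel" and p: "\<And>x. 0 \<le> p x" "\<And>x. p x \<le> 1"
    and int: "integrable lborel p"
  shows "(\<lambda>m. expectation (\<lambda>\<omega>. \<Prod>i<m. 1 - p (X i \<omega>))) \<longlonglongrightarrow> exp (- (lam * (\<integral>x. p x \<partial>lborel)))"
proof -
  define E where "E f m = expectation (\<lambda>\<omega>. \<Prod>i<m. 1 - f (X i \<omega>))" for f :: "'b \<Rightarrow> real" and m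
  obtain q where q: "incseq q" "\<And>l. simple_function lborel (q l)" "\<And>x. bdd_above (range (\<lambda>l. q l x))"
      "\<And>l x. 0 \<le> q l x" "p = (SUP l. q l)"
    using borel_measurable_implies_simple_function_sequence_real[of p lborel] p(1) by auto
  have p_eq: "p x = (SUP l. q l x)" for x
    by (simp add: q(5) image_comp)
  have q_le: "q l x \<le> p x" for l x
    unfolding p_eq using q(3) by (intro cSUP_upper) auto
  have q_le_1: "q l x \<le> 1" for l x
    using q_le[of l x] p(2)[of x] by linarith
  have q_lim: "(\<lambda>l. q l x) \<longlonglongrightarrow> p x" for x
    unfolding p_eq using q(1,3) by (intro LIMSEQ_incseq_SUP) (auto simp: incseq_def le_fun_def)
  have [measurable]: "q l \<in> borel_measurable borel" for l
    using borel_measurable_simple_function[OF q(2)] by simp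
  have E_anti: "E f n \<le> E f m" if [measurable]: "f \<in> borel_measurable borel"
      and "\<And>x. 0 \<le> f x" "\<And>x. f x \<le> 1" and "m \<le> n" for f m n
    unfolding E_def using that
    by (intro integral_mono point_prod_integrable point_prod_antimono) auto
  have int_q: "integrable lborel (q l)" for l
    by (rule Bochner_Integration.integrable_bound[OF int]) (auto simp: q(4) q_le order_trans[OF _ abs_ge_self])
  have simple: "E (q l) \<longlonglongrightarrow> exp (- (lam * (\<integral>x. q l x \<partial>lborel)))" for l
    unfolding E_def[abs_def]
  proof (rule laplace_functional_simple)
    show "finite (range (q l))"
      using simple_functionD(1)[OF q(2)[of l]] by simp
    have "(\<integral>\<^sup>+x. ennreal (q l x) \<partial>lborel) < \<infinity>"
      using int_q[of l] q(4) by (subst nn_integral_eq_integral) auto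
    moreover have "simple_function lborel (\<lambda>x. ennreal (q l x))"
      using q(2) by (rule simple_function_compose1)
    ultimately have "emeasure lborel {x\<in>space lborel. ennreal (q l x) \<noteq> 0} \<noteq> \<infinity>"
      by (intro simple_function_finite_support) auto
    moreover have "{x\<in>space lborel. ennreal (q l x) \<noteq> 0} = {x. q l x \<noteq> 0}"
      using q(4)[of l] by (auto simp: ennreal_eq_0_iff order_antisym)
    ultimately show "emeasure lborel {x. q l x \<noteq> 0} < \<infinity>"
      by (simp add: less_top)
  qed (auto simp: q(4) q_le_1)
  have int_lim: "(\<lambda>l. exp (- (lam * (\<integral>x. q l x \<partial>lborel)))) \<longlonglongrightarrow> exp (- (lam * (\<integral>x. p x \<partial>lborel)))"
    by (intro tendsto_intros integral_dominated_convergence[where w=p]) (auto simp: int q(4) q_le q_lim)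
  \<comment> \<open>For fixed \<open>m\<close>, each \<open>E (q l) m\<close> lies above its own
    limit in \<open>m\<close> and hence above the claimed value; then \<open>l\<close> tends to
    infinity inside a finite product.\<close>
  have lower: "exp (- (lam * (\<integral>x. p x \<partial>lborel))) \<le> E p m" for m
  proof (rule LIMSEQ_le_const)
    show "(\<lambda>l. E (q l) m) \<longlonglongrightarrow> E p m"
      unfolding E_def using point_prod_bounds[of "q _", OF q(4) q_le_1]
      by (intro integral_dominated_convergence[where w="\<lambda>_. 1"]) (auto intro!: tendsto_intros q_lim)
    have "exp (- (lam * (\<integral>x. p x \<partial>lborel))) \<le> E (q l) m" for l
    proof -
      have "exp (- (lam * (\<integral>x. p x \<partial>lborel))) \<le> exp (- (lam * (\<integral>x. q l x \<partial>lborel)))"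
        using lam by (auto intro!: mult_left_mono integral_mono int_q int q_le)
      also have "\<dots> \<le> E (q l) m"
        using simple[of l] by (rule LIMSEQ_le_const2) (auto intro!: exI[of _ m] E_anti q(4) q_le_1)
      finally show ?thesis .
    qed
    then show "\<exists>N. \<forall>l\<ge>N. exp (- (lam * (\<integral>x. p x \<partial>lborel))) \<le> E (q l) m"
      by blast
  qed
  have "decseq (E p)"
    unfolding decseq_def by (auto intro!: E_anti p)
  then obtain L where L: "E p \<longlonglongrightarrow> L"
    using decseq_convergent[of "E p" "exp (- (lam * (\<integral>x. p x \<partial>lborel)))"] lower by blast
  \<comment> \<open>The reverse order of limits: \<open>E p m\<close> lies below
    \<open>E (q l) m\<close>, so \<open>m\<close> goes first and \<open>l\<close> second.\<close>
  have "L \<le> exp (- (lam * (\<integral>x. q l x \<partial>lborel)))" for l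
  proof (rule LIMSEQ_le[OF L simple])
    have "E p m \<le> E (q l) m" for m
      unfolding E_def using p q(4) q_le q_le_1
      by (intro integral_mono point_prod_integrable prod_mono) (auto simp: algebra_simps)
    then show "\<exists>N. \<forall>m\<ge>N. E p m \<le> E (q l) m"
      by blast
  qed
  then have "L \<le> exp (- (lam * (\<integral>x. p x \<partial>lborel)))"
    using int_lim by (intro LIMSEQ_le_const) auto
  moreover have "exp (- (lam * (\<integral>x. p x \<partial>lborel))) \<le> L"
    using L lower by (intro LIMSEQ_le_const) auto
  ultimately have "L = exp (- (lam * (\<integral>x. p x \<partial>lborel)))"
    by (rule order.antisym)
  with L show ?thesis
    by (simp add: E_def[abs_def])
qed

end

end

section \<open>Independence of nodes, motions and target\<close>

context prob_space
begin

text \<open>Conditioning on the first variable without conditional probabilities: by independence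
  the joint law is the product law, and the integrand keeps the first argument frozen. It is applied
  to starting points against motions and to the target against all nodes.\<close>

lemma indep_fubini:
  assumes ind: "independent_variables M N\<^sub>1 Y\<^sub>1 N\<^sub>2 Y\<^sub>2"
    and P [measurable]: "Measurable.pred (N\<^sub>1 \<Otimes>\<^sub>M N\<^sub>2) (\<lambda>z. P (fst z) (snd z))"
  shows "emeasure M {\<omega>\<in>space M. P (Y\<^sub>1 \<omega>) (Y\<^sub>2 \<omega>)} =
    (\<integral>\<^sup>+\<omega>. emeasure M {\<omega>'\<in>space M. P (Y\<^sub>1 \<omega>) (Y\<^sub>2 \<omega>')} \<partial>M)"
proof -
  have Y [measurable]: "Y\<^sub>1 \<in> measurable M N\<^sub>1" "Y\<^sub>2 \<in> measurable M N\<^sub>2"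
    using ind by (auto simp: independent_variables_def)
  interpret D1: prob_space "distr M N\<^sub>1 Y\<^sub>1" by (rule prob_space_distr) simp
  interpret D2: prob_space "distr M N\<^sub>2 Y\<^sub>2" by (rule prob_space_distr) simp
  have joint: "distr M N\<^sub>1 Y\<^sub>1 \<Otimes>\<^sub>M distr M N\<^sub>2 Y\<^sub>2 = distr M (N\<^sub>1 \<Otimes>\<^sub>M N\<^sub>2) (\<lambda>\<omega>. (Y\<^sub>1 \<omega>, Y\<^sub>2 \<omega>))"
  proof (rule pair_measure_eqI)
    show "sigma_finite_measure (distr M N\<^sub>1 Y\<^sub>1)" "sigma_finite_measure (distr M N\<^sub>2 Y\<^sub>2)"
      by unfold_locales
    show "sets (distr M N\<^sub>1 Y\<^sub>1 \<Otimes>\<^sub>M distr M N\<^sub>2 Y\<^sub>2) = sets (distr M (N\<^sub>1 \<Otimes>\<^sub>M N\<^sub>2) (\<lambda>\<omega>. (Y\<^sub>1 \<omega>, Y\<^sub>2 \<omega>)))"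
      by (simp cong: sets_pair_measure_cong)
    fix A B assume A: "A \<in> sets (distr M N\<^sub>1 Y\<^sub>1)" and B: "B \<in> sets (distr M N\<^sub>2 Y\<^sub>2)"
    have "emeasure (distr M (N\<^sub>1 \<Otimes>\<^sub>M N\<^sub>2) (\<lambda>\<omega>. (Y\<^sub>1 \<omega>, Y\<^sub>2 \<omega>))) (A \<times> B) =
        emeasure M ((Y\<^sub>1 -` A \<inter> space M) \<inter> (Y\<^sub>2 -` B \<inter> space M))"
      using A B by (subst emeasure_distr) (auto intro!: arg_cong[where f="emeasure M"])
    also have "\<dots> = ennreal (prob (Y\<^sub>1 -` A \<inter> space M) * prob (Y\<^sub>2 -` B \<inter> space M))"
      unfolding emeasure_eq_measure using ind A B
      by (intro arg_cong[where f=ennreal] indep_setD) (auto simp: independent_variables_def)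
    also have "\<dots> = emeasure (distr M N\<^sub>1 Y\<^sub>1) A * emeasure (distr M N\<^sub>2 Y\<^sub>2) B"
      using A B by (simp add: emeasure_distr emeasure_eq_measure ennreal_mult)
    finally show "emeasure (distr M N\<^sub>1 Y\<^sub>1) A * emeasure (distr M N\<^sub>2 Y\<^sub>2) B =
        emeasure (distr M (N\<^sub>1 \<Otimes>\<^sub>M N\<^sub>2) (\<lambda>\<omega>. (Y\<^sub>1 \<omega>, Y\<^sub>2 \<omega>))) (A \<times> B)" ..
  qed
  define Q where "Q = {z\<in>space (N\<^sub>1 \<Otimes>\<^sub>M N\<^sub>2). P (fst z) (snd z)}"
  have Q [measurable]: "Q \<in> sets (N\<^sub>1 \<Otimes>\<^sub>M N\<^sub>2)"
    unfolding Q_def by measurable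
  have "emeasure M {\<omega>\<in>space M. P (Y\<^sub>1 \<omega>) (Y\<^sub>2 \<omega>)} = emeasure (distr M (N\<^sub>1 \<Otimes>\<^sub>M N\<^sub>2) (\<lambda>\<omega>. (Y\<^sub>1 \<omega>, Y\<^sub>2 \<omega>))) Q"
    using Y[THEN measurable_space]
    by (subst emeasure_distr) (auto simp: Q_def space_pair_measure intro!: arg_cong[where f="emeasure M"])
  also have "\<dots> = (\<integral>\<^sup>+y. emeasure (distr M N\<^sub>2 Y\<^sub>2) (Pair y -` Q) \<partial>distr M N\<^sub>1 Y\<^sub>1)"
    unfolding joint[symmetric] by (rule D2.emeasure_pair_measure_alt) (simp cong: sets_pair_measure_cong add: Q)
  also have "\<dots> = (\<integral>\<^sup>+\<omega>. emeasure (distr M N\<^sub>2 Y\<^sub>2) (Pair (Y\<^sub>1 \<omega>) -` Q) \<partial>M)"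
  proof -
    have "(\<lambda>y. emeasure (distr M N\<^sub>2 Y\<^sub>2) (Pair y -` Q)) \<in> borel_measurable N\<^sub>1"
      by (rule D2.measurable_emeasure_Pair) (simp cong: sets_pair_measure_cong add: Q)
    then show ?thesis
      by (subst nn_integral_distr) auto
  qed
  also have "\<dots> = (\<integral>\<^sup>+\<omega>. emeasure M {\<omega>'\<in>space M. P (Y\<^sub>1 \<omega>) (Y\<^sub>2 \<omega>')} \<partial>M)"
  proof (rule nn_integral_cong)
    fix \<omega> assume "\<omega> \<in> space M"
    then show "emeasure (distr M N\<^sub>2 Y\<^sub>2) (Pair (Y\<^sub>1 \<omega>) -` Q) = emeasure M {\<omega>'\<in>space M. P (Y\<^sub>1 \<omega>) (Y\<^sub>2 \<omega>')}"
      using Y[THEN measurable_space] sets_Pair1[OF Q, of "Y\<^sub>1 \<omega>"]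
      by (subst emeasure_distr) (auto simp: Q_def space_pair_measure intro!: arg_cong[where f="emeasure M"])
  qed
  finally show ?thesis .
qed

lemma indep_prob:
  assumes ind: "independent_variables M N\<^sub>1 Y\<^sub>1 N\<^sub>2 Y\<^sub>2"
    and [measurable]: "Measurable.pred N\<^sub>1 P" "Measurable.pred N\<^sub>2 Q"
  shows "prob {\<omega>\<in>space M. P (Y\<^sub>1 \<omega>) \<and> Q (Y\<^sub>2 \<omega>)} =
    prob {\<omega>\<in>space M. P (Y\<^sub>1 \<omega>)} * prob {\<omega>\<in>space M. Q (Y\<^sub>2 \<omega>)}"
proof -
  have Y: "Y\<^sub>1 \<in> measurable M N\<^sub>1" "Y\<^sub>2 \<in> measurable M N\<^sub>2"
    using ind by (auto simp: independent_variables_def)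
  have eq: "{\<omega>\<in>space M. P (Y\<^sub>1 \<omega>)} = Y\<^sub>1 -` {x\<in>space N\<^sub>1. P x} \<inter> space M"
      "{\<omega>\<in>space M. Q (Y\<^sub>2 \<omega>)} = Y\<^sub>2 -` {x\<in>space N\<^sub>2. Q x} \<inter> space M"
    using Y[THEN measurable_space] by auto
  have sets: "{x\<in>space N\<^sub>1. P x} \<in> sets N\<^sub>1" "{x\<in>space N\<^sub>2. Q x} \<in> sets N\<^sub>2"
    by measurable
  have "prob ({\<omega>\<in>space M. P (Y\<^sub>1 \<omega>)} \<inter> {\<omega>\<in>space M. Q (Y\<^sub>2 \<omega>)}) =
    prob {\<omega>\<in>space M. P (Y\<^sub>1 \<omega>)} * prob {\<omega>\<in>space M. Q (Y\<^sub>2 \<omega>)}"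
    unfolding eq using ind unfolding independent_variables_def
    by (elim conjE, intro indep_setD) (use sets in blast)+
  moreover have "{\<omega>\<in>space M. P (Y\<^sub>1 \<omega>)} \<inter> {\<omega>\<in>space M. Q (Y\<^sub>2 \<omega>)} = {\<omega>\<in>space M. P (Y\<^sub>1 \<omega>) \<and> Q (Y\<^sub>2 \<omega>)}"
    by auto
  ultimately show ?thesis by simp
qed

context
  fixes X :: "nat \<Rightarrow> 'a \<Rightarrow> 'b::euclidean_space" and \<zeta> :: "nat \<Rightarrow> real \<Rightarrow> 'a \<Rightarrow> 'b" and lam :: real
  assumes nodes: "mobile_nodes M lam X \<zeta>"
begin

lemma node_bm: "standard_brownian_motion M (\<zeta> i)"
  using nodes by (simp add: mobile_nodes_def)

lemma node_measurable [measurable]: "X i \<in> borel_measurable M"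
  using nodes by (simp add: mobile_nodes_def poisson_point_process_def)

lemma motion_measurable: "0 \<le> s \<Longrightarrow> \<zeta> i s \<in> borel_measurable M"
  using node_bm[of i] by (simp add: standard_brownian_motion_def continuous_process_def)

text \<open>With the starting points frozen, the independent motions give a product of single-node
  probabilities, each one minus \<open>hit\<close>; \<open>indep_fubini\<close> then averages over
  the starting points.\<close>

lemma prob_first_nodes_avoid:
  assumes \<delta>: "0 \<le> \<delta>" and C [measurable]: "\<And>k. C k \<in> sets borel"
  shows "prob {\<omega>\<in>space M. \<forall>i<m. \<forall>k\<le>n. X i \<omega> + \<zeta> i (real k * \<delta>) \<omega> \<notin> C k} =
    expectation (\<lambda>\<omega>. \<Prod>i<m. 1 - enn2real (random_walk.hit (gauss_law \<delta>) n C (X i \<omega>)))"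
proof -
  interpret G: random_walk "gauss_law \<delta> :: 'b measure"
    using \<delta> by (rule random_walk_gauss_law)
  define p where "p x = enn2real (G.hit n C x)" for x
  have p: "G.hit n C x = ennreal (p x)" "0 \<le> p x" "p x \<le> 1" for x
    using G.hit_le_1[of n C x] by (auto simp: p_def enn2real_leI G.ennreal_enn2real_hit)
  have p_measurable [measurable]: "p \<in> borel_measurable borel"
    unfolding p_def[abs_def] by measurable
  have single: "prob {\<omega>\<in>space M. \<forall>k\<le>n. x + \<zeta> i (real k * \<delta>) \<omega> \<notin> C k} = 1 - p x" for i x
  proof -
    have [measurable]: "\<zeta> i (real k * \<delta>) \<in> borel_measurable M" for k
      using \<delta> by (intro motion_measurable) simp
    have "{\<omega>\<in>space M. \<exists>k\<le>n. x + \<zeta> i (real k * \<delta>) \<omega> \<in> C k} \<in> events"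
      by measurable
    then have "prob (space M - {\<omega>\<in>space M. \<exists>k\<le>n. x + \<zeta> i (real k * \<delta>) \<omega> \<in> C k}) =
        1 - prob {\<omega>\<in>space M. \<exists>k\<le>n. x + \<zeta> i (real k * \<delta>) \<omega> \<in> C k}"
      by (rule prob_compl)
    also have "prob {\<omega>\<in>space M. \<exists>k\<le>n. x + \<zeta> i (real k * \<delta>) \<omega> \<in> C k} = p x"
      by (simp add: measure_def grid_hit[OF node_bm \<delta> C] p_def)
    also have "space M - {\<omega>\<in>space M. \<exists>k\<le>n. x + \<zeta> i (real k * \<delta>) \<omega> \<in> C k} =
        {\<omega>\<in>space M. \<forall>k\<le>n. x + \<zeta> i (real k * \<delta>) \<omega> \<notin> C k}"
      by auto
    finally show ?thesis .
  qed
  have paths: "indep_vars (\<lambda>_. path_space) (\<lambda>i. sample_path (\<zeta> i)) UNIV"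
    and ind: "independent_variables M (\<Pi>\<^sub>M i\<in>UNIV. borel) (\<lambda>\<omega> i. X i \<omega>)
       (\<Pi>\<^sub>M i\<in>UNIV. path_space) (\<lambda>\<omega> i. sample_path (\<zeta> i) \<omega>)"
    using nodes by (simp_all add: mobile_nodes_def)
  have path: "sample_path (\<zeta> i) \<omega> (real k * \<delta>) = \<zeta> i (real k * \<delta>) \<omega>" for i k \<omega>
    using \<delta> by (simp add: sample_path_def)
  have fixed: "emeasure M {\<omega>\<in>space M. \<forall>i<m. \<forall>k\<le>n. x i + sample_path (\<zeta> i) \<omega> (real k * \<delta>) \<notin> C k} =
      ennreal (\<Prod>i<m. 1 - p (x i))" for x :: "nat \<Rightarrow> 'b"
  proof (cases "m = 0")
    case True
    then show ?thesis by (simp add: emeasure_space_1)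
  next
    case False
    let ?A = "\<lambda>i. {p\<in>space path_space. \<forall>k\<le>n. x i + p (real k * \<delta>) \<notin> C k}"
    have A: "?A i \<in> sets path_space" for i
    proof -
      have [measurable]: "(\<lambda>p. p (real k * \<delta>)) \<in> measurable path_space (borel :: 'b measure)" for k
        using \<delta> by (intro path_space_component) simp
      show ?thesis by measurable
    qed
    have vim: "sample_path (\<zeta> i) -` ?A i \<inter> space M = {\<omega>\<in>space M. \<forall>k\<le>n. x i + \<zeta> i (real k * \<delta>) \<omega> \<notin> C k}" for i
    proof -
      have "sample_path (\<zeta> i) \<in> measurable M path_space"
        using node_bm[of i] by (intro sample_path_measurable) (simp add: standard_brownian_motion_def)
      from measurable_space[OF this] show ?thesis
        by (auto simp: path)
    qed
    have "prob (\<Inter>i\<in>{..<m}. sample_path (\<zeta> i) -` ?A i \<inter> space M) = (\<Prod>i<m. prob (sample_path (\<zeta> i) -` ?A i \<inter> space M))"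
    proof (rule indep_varsD[OF paths, of "{..<m}" ?A])
      show "{..<m} \<noteq> {}"
        using False by (simp add: lessThan_empty_iff)
    qed (simp_all only: finite_lessThan subset_UNIV A)
    also have "\<dots> = (\<Prod>i<m. 1 - p (x i))"
      by (simp only: vim single)
    also have "(\<Inter>i\<in>{..<m}. sample_path (\<zeta> i) -` ?A i \<inter> space M) =
        {\<omega>\<in>space M. \<forall>i<m. \<forall>k\<le>n. x i + sample_path (\<zeta> i) \<omega> (real k * \<delta>) \<notin> C k}"
      unfolding vim path using False by auto
    finally show ?thesis
      by (simp add: emeasure_eq_measure)
  qed
  have "emeasure M {\<omega>\<in>space M. \<forall>i<m. \<forall>k\<le>n. X i \<omega> + sample_path (\<zeta> i) \<omega> (real k * \<delta>) \<notin> C k} =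
    (\<integral>\<^sup>+\<omega>. emeasure M {\<omega>'\<in>space M. \<forall>i<m. \<forall>k\<le>n. X i \<omega> + sample_path (\<zeta> i) \<omega>' (real k * \<delta>) \<notin> C k} \<partial>M)"
  proof (rule indep_fubini[OF ind])
    have [measurable]: "(\<lambda>z. snd z i (real k * \<delta>)) \<in>
        borel_measurable ((\<Pi>\<^sub>M i\<in>UNIV. borel :: 'b measure) \<Otimes>\<^sub>M (\<Pi>\<^sub>M i\<in>UNIV. path_space :: (real \<Rightarrow> 'b) measure))" for i :: nat and k
      using \<delta> by (intro measurable_compose[OF _ path_space_component]
          measurable_compose[OF measurable_snd measurable_component_singleton]) auto
    show "Measurable.pred ((\<Pi>\<^sub>M i\<in>UNIV. borel) \<Otimes>\<^sub>M (\<Pi>\<^sub>M i\<in>UNIV. path_space))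
        (\<lambda>z. \<forall>i<m. \<forall>k\<le>n. fst z i + snd z i (real k * \<delta>) \<notin> C k)"
      by measurable
  qed
  also have "\<dots> = (\<integral>\<^sup>+\<omega>. ennreal (\<Prod>i<m. 1 - p (X i \<omega>)) \<partial>M)"
    by (simp only: fixed)
  also have "\<dots> = ennreal (expectation (\<lambda>\<omega>. \<Prod>i<m. 1 - p (X i \<omega>)))"
    using p by (intro nn_integral_eq_integral integrable_const_bound[where B=1])
      (auto simp: prod_nonneg prod_le_1 abs_prod)
  finally show ?thesis
    using p by (simp add: path measure_def p_def[symmetric] prod_nonneg integral_nonneg_AE)
qed

text \<open>The void probability of a thinned Poisson process, obtained from the Laplace functional
  with \<open>hit\<close> as the retention probability. The events for the first \<open>m\<close>
  nodes decrease to the event for all of them.\<close>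

lemma prob_nodes_avoid:
  assumes lam: "0 \<le> lam" and \<delta>: "0 \<le> \<delta>" and C [measurable]: "\<And>k. C k \<in> sets borel"
    and fin: "(\<integral>\<^sup>+x. random_walk.hit (gauss_law \<delta>) n C x \<partial>lborel) = ennreal v" and v: "0 \<le> v"
  shows "prob {\<omega>\<in>space M. \<forall>i. \<forall>k\<le>n. X i \<omega> + \<zeta> i (real k * \<delta>) \<omega> \<notin> C k} = exp (- (lam * v))"
proof -
  interpret G: random_walk "gauss_law \<delta> :: 'b measure"
    using \<delta> by (rule random_walk_gauss_law)
  define p where "p x = enn2real (G.hit n C x)" for x
  have p: "G.hit n C x = ennreal (p x)" "0 \<le> p x" "p x \<le> 1" for x
    using G.hit_le_1[of n C x] by (auto simp: p_def enn2real_leI G.ennreal_enn2real_hit)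
  have p_measurable [measurable]: "p \<in> borel_measurable borel"
    unfolding p_def[abs_def] by measurable
  have int: "(\<integral>\<^sup>+x. ennreal (p x) \<partial>lborel) = ennreal v"
    using fin by (simp add: p(1))
  define A where "A m = {\<omega>\<in>space M. \<forall>i<m. \<forall>k\<le>n. X i \<omega> + \<zeta> i (real k * \<delta>) \<omega> \<notin> C k}" for m
  have [measurable]: "\<zeta> i (real k * \<delta>) \<in> borel_measurable M" for i k
    using \<delta> by (intro motion_measurable) simp
  have "(\<lambda>m. expectation (\<lambda>\<omega>. \<Prod>i<m. 1 - p (X i \<omega>))) \<longlonglongrightarrow> exp (- (lam * (\<integral>x. p x \<partial>lborel)))"
  proof (rule laplace_functional[OF lam])
    show "poisson_point_process M lam X"
      using nodes by (simp add: mobile_nodes_def)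
    show "integrable lborel p"
      using int p(2) by (intro integrableI_nonneg) auto
  qed (auto simp: p)
  moreover have "(\<integral>x. p x \<partial>lborel) = v"
    using int p(2) v by (subst integral_eq_nn_integral) auto
  moreover have "prob (A m) = expectation (\<lambda>\<omega>. \<Prod>i<m. 1 - p (X i \<omega>))" for m
    unfolding A_def p_def by (rule prob_first_nodes_avoid[OF \<delta> C])
  ultimately have "(\<lambda>m. prob (A m)) \<longlonglongrightarrow> exp (- (lam * v))"
    by simp
  moreover have "(\<lambda>m. prob (A m)) \<longlonglongrightarrow> prob (\<Inter>m. A m)"
  proof (rule finite_Lim_measure_decseq)
    show "range A \<subseteq> events"
      unfolding A_def by auto
    show "decseq A"
      by (auto simp: decseq_def A_def)
  qed
  ultimately have "prob (\<Inter>m. A m) = exp (- (lam * v))"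
    by (rule LIMSEQ_unique[rotated])
  moreover have "(\<Inter>m. A m) = {\<omega>\<in>space M. \<forall>i. \<forall>k\<le>n. X i \<omega> + \<zeta> i (real k * \<delta>) \<omega> \<notin> C k}"
    unfolding A_def by blast
  ultimately show ?thesis by simp
qed

end

end

section \<open>Paths on dyadic grids\<close>

lemma continuous_on_dyadic_closed:
  fixes f :: "real \<Rightarrow> 'b::metric_space"
  assumes f: "continuous_on {0..T} f" and C: "closed C" and T: "0 < T"
    and grid: "\<And>m k. k \<le> 2 ^ m \<Longrightarrow> f (real k * (T / 2 ^ m)) \<in> C"
    and s: "s \<in> {0..T}"
  shows "f s \<in> C"
proof -
  \<comment> \<open>\<open>z m\<close> will be the last grid point not beyond \<open>s\<close>, at
    distance at most \<open>T / 2 ^ m\<close>.\<close>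
  define k where "k m = nat \<lfloor>s / T * 2 ^ m\<rfloor>" for m :: nat
  define z where "z m = real (k m) * (T / 2 ^ m)" for m
  have pos: "0 \<le> s / T * 2 ^ m" for m :: nat
    using s T by simp
  have k_le: "real (k m) \<le> s / T * 2 ^ m" and k_ge: "s / T * 2 ^ m - 1 \<le> real (k m)" for m
    using pos[of m] by (auto simp: k_def of_nat_nat)
  have "s / T \<le> 1"
    using s T by simp
  have k_bound: "k m \<le> 2 ^ m" for m
  proof -
    have "real (k m) \<le> 1 * 2 ^ m"
      using \<open>s / T \<le> 1\<close> by (intro order_trans[OF k_le] mult_right_mono) auto
    then show ?thesis
      by simp
  qed
  have z_le: "z m \<le> s" and z_ge: "s - T / 2 ^ m \<le> z m" for m
  proof -
    have "z m \<le> s / T * 2 ^ m * (T / 2 ^ m)"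
      unfolding z_def using T by (intro mult_right_mono k_le) auto
    then show "z m \<le> s" using T by simp
    have "(s / T * 2 ^ m - 1) * (T / 2 ^ m) \<le> z m"
      unfolding z_def using T by (intro mult_right_mono k_ge) auto
    moreover have "(s / T * 2 ^ m - 1) * (T / 2 ^ m) = s - T / 2 ^ m"
      using T by (simp add: field_simps)
    ultimately show "s - T / 2 ^ m \<le> z m" by simp
  qed
  have "(\<lambda>m. T / 2 ^ m) \<longlonglongrightarrow> 0"
    using tendsto_mult_right_zero[OF LIMSEQ_power_zero[of "1 / 2 :: real"], of T]
    by (simp add: power_divide)
  then have "(\<lambda>m. s - T / 2 ^ m) \<longlonglongrightarrow> s - 0"
    by (intro tendsto_diff tendsto_const)
  then have "z \<longlonglongrightarrow> s"
    by (intro tendsto_sandwich[of "\<lambda>m. s - T / 2 ^ m" z sequentially "\<lambda>_. s"] always_eventually allI z_le z_ge) auto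
  moreover have "z m \<in> {0..T}" for m
    using z_le[of m] s T by (auto simp: z_def)
  ultimately have "(\<lambda>m. f (z m)) \<longlonglongrightarrow> f s"
    using f s by (auto simp: continuous_on_sequentially o_def)
  then show ?thesis
    using C grid[OF k_bound] by (intro Lim_in_closed_set[of C "\<lambda>m. f (z m)"]) (auto simp: z_def)
qed

text \<open>A strict inequality is not stable under limits of grid points; attainment of the minimum
  on the compact interval provides the uniform margin \<open>1 / real (Suc j)\<close>. The right
  side involves countably many times only, which gives measurability.\<close>

lemma continuous_gt_on_interval_iff:
  fixes f :: "real \<Rightarrow> real"
  assumes f: "continuous_on {0..T} f" and T: "0 < T"
  shows "(\<forall>s\<in>{0..T}. r < f s) \<longleftrightarrow>
    (\<exists>j. \<forall>m. \<forall>k\<le>2 ^ m. r + 1 / real (Suc j) \<le> f (real k * (T / 2 ^ m)))"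
proof
  assume gt: "\<forall>s\<in>{0..T}. r < f s"
  obtain s0 where s0: "s0 \<in> {0..T}" "\<And>s. s \<in> {0..T} \<Longrightarrow> f s0 \<le> f s"
    using continuous_attains_inf[OF _ _ f] T by auto
  obtain j where j: "inverse (real (Suc j)) < f s0 - r"
    using reals_Archimedean[of "f s0 - r"] gt s0(1) by auto
  have "r + 1 / real (Suc j) \<le> f (real k * (T / 2 ^ m))" if "k \<le> 2 ^ m" for k m
  proof -
    have "real k \<le> 2 ^ m"
      using that by simp
    then have "real k * (T / 2 ^ m) \<le> 2 ^ m * (T / 2 ^ m)"
      using T by (intro mult_right_mono) auto
    then have "f s0 \<le> f (real k * (T / 2 ^ m))"
      using T by (intro s0(2)) auto
    then show ?thesis using j by (simp add: inverse_eq_divide)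
  qed
  then show "\<exists>j. \<forall>m. \<forall>k\<le>2 ^ m. r + 1 / real (Suc j) \<le> f (real k * (T / 2 ^ m))"
    by (intro exI[of _ j] allI impI)
next
  assume "\<exists>j. \<forall>m. \<forall>k\<le>2 ^ m. r + 1 / real (Suc j) \<le> f (real k * (T / 2 ^ m))"
  then obtain j where j: "\<And>m k. k \<le> 2 ^ m \<Longrightarrow> r + 1 / real (Suc j) \<le> f (real k * (T / 2 ^ m))"
    by blast
  show "\<forall>s\<in>{0..T}. r < f s"
  proof
    fix s assume "s \<in> {0..T}"
    have "r < r + 1 / real (Suc j)"
      by simp
    also have "\<dots> \<le> f s"
    proof -
      have "f s \<in> {r + 1 / real (Suc j)..}"
      proof (rule continuous_on_dyadic_closed[OF f closed_atLeast T _ \<open>s \<in> {0..T}\<close>])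
        fix m k :: nat assume "k \<le> 2 ^ m"
        then show "f (real k * (T / 2 ^ m)) \<in> {r + 1 / real (Suc j)..}"
          unfolding atLeast_iff by (rule j)
      qed
      then show ?thesis
        by (rule atLeast_iff[THEN iffD1])
    qed
    finally show "r < f s" .
  qed
qed

text \<open>Absence of detection on \<open>{0..t}\<close> would not suffice: with infinitely many
  nodes, detection times could accumulate at \<open>t\<close> from the right and make the infimum
  equal to \<open>t\<close>. Hence the slightly longer interval.\<close>

lemma detection_time_gt_iff:
  assumes "0 \<le> t"
  shows "ereal t < detection_time X \<zeta> r g \<omega> \<longleftrightarrow>
    (\<exists>N. \<forall>i. \<forall>s\<in>{0..t + 1 / real (Suc N)}. r < dist (X i \<omega> + \<zeta> i s \<omega>) (g s \<omega>))"
    (is "_ \<longleftrightarrow> ?R")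
  unfolding detection_time_def
proof
  let ?S = "{s. 0 \<le> s \<and> g s \<omega> \<in> (\<Union>i. cball (X i \<omega> + \<zeta> i s \<omega>) r)}"
  assume "ereal t < Inf (ereal ` ?S)"
  then obtain y where y: "ereal t < ereal y" "ereal y < Inf (ereal ` ?S)"
    using ereal_dense2 by blast
  then obtain N where N: "inverse (real (Suc N)) < y - t"
    using reals_Archimedean[of "y - t"] by auto
  have "s \<notin> ?S" if "s \<in> {0..t + 1 / real (Suc N)}" for s
  proof
    assume "s \<in> ?S"
    then have "Inf (ereal ` ?S) \<le> ereal s"
      by (intro Inf_lower imageI)
    then have "ereal y < ereal s"
      using y(2) by (rule less_le_trans[rotated])
    then show False
      using that N by (simp add: inverse_eq_divide)
  qed
  then show ?R
    by (intro exI[of _ N]) (force simp: not_le)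
next
  let ?S = "{s. 0 \<le> s \<and> g s \<omega> \<in> (\<Union>i. cball (X i \<omega> + \<zeta> i s \<omega>) r)}"
  assume ?R
  then obtain N where N: "\<And>i s. s \<in> {0..t + 1 / real (Suc N)} \<Longrightarrow> r < dist (X i \<omega> + \<zeta> i s \<omega>) (g s \<omega>)"
    by blast
  have "ereal (t + 1 / real (Suc N)) \<le> Inf (ereal ` ?S)"
  proof (rule Inf_greatest, safe)
    fix s i assume "0 \<le> s" "g s \<omega> \<in> cball (X i \<omega> + \<zeta> i s \<omega>) r"
    with N[of s i] show "ereal (t + 1 / real (Suc N)) \<le> ereal s"
      by (cases "s \<le> t + 1 / real (Suc N)") (auto simp del: of_nat_Suc)
  qed
  moreover have "ereal t < ereal (t + 1 / real (Suc N))"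
    by simp
  ultimately show "ereal t < Inf (ereal ` ?S)"
    by (rule less_le_trans[rotated])
qed

section \<open>Bounds on the detection probability\<close>

context prob_space
begin

context
  fixes X :: "nat \<Rightarrow> 'a \<Rightarrow> real ^ 2" and \<zeta> :: "nat \<Rightarrow> real \<Rightarrow> 'a \<Rightarrow> real ^ 2"
    and g :: "real \<Rightarrow> 'a \<Rightarrow> real ^ 2" and lam r :: real
  assumes nodes: "mobile_nodes M lam X \<zeta>" and g: "continuous_process M g"
begin

lemma target_measurable: "0 \<le> s \<Longrightarrow> g s \<in> borel_measurable M"
  using g by (simp add: continuous_process_def)

text \<open>In the lower bound this event is the larger one, and monotonicity of the measure then
  requires it to be measurable.\<close>

lemma detection_event:
  assumes "0 \<le> t"
  shows "{\<omega>\<in>space M. ereal t < detection_time X \<zeta> r g \<omega>} \<in> events"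
proof -
  have event: "{\<omega>\<in>space M. \<forall>s\<in>{0..T}. r < dist (X i \<omega> + \<zeta> i s \<omega>) (g s \<omega>)} \<in> events" if T: "0 < T" for i T
  proof -
    have "continuous_on {0..T} (\<lambda>s. dist (X i \<omega> + \<zeta> i s \<omega>) (g s \<omega>))" if "\<omega> \<in> space M" for \<omega>
    proof -
      have "continuous_on {0..} (\<lambda>s. g s \<omega>)" "continuous_on {0..} (\<lambda>s. \<zeta> i s \<omega>)"
        using g node_bm[OF nodes, of i] that
        by (auto simp: continuous_process_def standard_brownian_motion_def)
      then show ?thesis
        by (intro continuous_intros) (auto intro: continuous_on_subset)
    qed
    then have "{\<omega>\<in>space M. \<forall>s\<in>{0..T}. r < dist (X i \<omega> + \<zeta> i s \<omega>) (g s \<omega>)} =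
      {\<omega>\<in>space M. \<exists>j. \<forall>m. \<forall>k\<le>2 ^ m. r + 1 / real (Suc j) \<le>
        dist (X i \<omega> + \<zeta> i (real k * (T / 2 ^ m)) \<omega>) (g (real k * (T / 2 ^ m)) \<omega>)}"
      using continuous_gt_on_interval_iff[OF _ T] by (intro Collect_cong conj_cong refl) auto
    also have "\<dots> \<in> events"
    proof -
      have [measurable]: "g (real k * (T / 2 ^ m)) \<in> borel_measurable M"
          "\<zeta> i (real k * (T / 2 ^ m)) \<in> borel_measurable M" for k and m :: nat
        using T by (auto intro!: target_measurable motion_measurable[OF nodes])
      note node_measurable[OF nodes, measurable]
      show ?thesis by measurable
    qed
    finally show ?thesis .
  qed
  have pos: "0 < t + 1 / real (Suc N)" for N
    using assms by (intro add_nonneg_pos) auto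
  show ?thesis
    unfolding detection_time_gt_iff[OF assms]
    by (intro sets.sets_Collect_countable_Ex sets.sets_Collect_countable_All event pos)
qed

text \<open>For a frozen target path the discs are deterministic and \<open>plane_hit_ge\<close>
  applies. The resulting bound is the same for every path, so integrating over the target loses
  nothing.\<close>

lemma undetected_le:
  assumes lam: "0 \<le> lam" and ind: "independent_of_nodes M X \<zeta> g"
    and r: "0 \<le> r" and t: "real n \<le> t"
  shows "prob {\<omega>\<in>space M. ereal t < detection_time X \<zeta> r g \<omega>} \<le>
    exp (- (lam * (pi * r\<^sup>2 * real (Suc n) / (1 + r\<^sup>2 / 2 * harm n))))"
    (is "_ \<le> ?b")
proof -
  have gm [measurable]: "g (real k) \<in> borel_measurable M" "\<zeta> i (real k) \<in> borel_measurable M" for i k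
    by (auto intro!: target_measurable motion_measurable[OF nodes])
  note node_measurable[OF nodes, measurable]
  have fixed: "prob {\<omega>\<in>space M. \<forall>i. \<forall>k\<le>n. X i \<omega> + \<zeta> i (real k) \<omega> \<notin> cball (c k) r} \<le> ?b"
    for c :: "nat \<Rightarrow> real ^ 2"
  proof -
    interpret G: random_walk "gauss_law 1 :: (real ^ 2) measure"
      by (rule random_walk_gauss_law) simp
    let ?C = "\<lambda>k. cball (c k) r"
    let ?v = "pi * r\<^sup>2 * real (Suc n) / (1 + r\<^sup>2 / 2 * harm n)"
    \<comment> \<open>The void probability formula requires a finite volume; the occupation number
      supplies a crude bound.\<close>
    have "(\<integral>\<^sup>+x. G.hit n ?C x \<partial>lborel) \<le> (\<integral>\<^sup>+x. G.occ n ?C x \<partial>lborel)"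
      by (intro nn_integral_mono G.hit_le_occ) auto
    also have "\<dots> = (\<Sum>k\<le>n. emeasure lborel (?C k))"
      by (rule G.nn_integral_occ) auto
    also have "\<dots> < \<infinity>"
      using r by (simp add: emeasure_ball_plane less_top[symmetric] ennreal_mult_eq_top_iff)
    finally obtain v where v: "(\<integral>\<^sup>+x. G.hit n ?C x \<partial>lborel) = ennreal v" "0 \<le> v"
      by (cases "\<integral>\<^sup>+x. G.hit n ?C x \<partial>lborel") auto
    have "ennreal ?v \<le> ennreal v"
      unfolding v(1)[symmetric] using r
      by (intro plane_hit_ge[OF node_bm[OF nodes]]) (auto simp: emeasure_ball_plane)
    then have "lam * ?v \<le> lam * v"
      using v(2) lam by (intro mult_left_mono) auto
    then have "exp (- (lam * v)) \<le> ?b"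
      by (simp only: exp_le_cancel_iff neg_le_iff_le)
    moreover have "prob {\<omega>\<in>space M. \<forall>i. \<forall>k\<le>n. X i \<omega> + \<zeta> i (real k * 1) \<omega> \<notin> ?C k} = exp (- (lam * v))"
      by (rule prob_nodes_avoid[OF nodes lam _ _ v]) auto
    ultimately show ?thesis
      by (simp only: mult_1_right)
  qed
  let ?U = "{\<omega>\<in>space M. \<forall>i. \<forall>k\<le>n. X i \<omega> + \<zeta> i (real k) \<omega> \<notin> cball (g (real k) \<omega>) r}"
  have "{\<omega>\<in>space M. ereal t < detection_time X \<zeta> r g \<omega>} \<subseteq> ?U"
  proof safe
    fix \<omega> i k
    assume undetected: "ereal t < detection_time X \<zeta> r g \<omega>" and "k \<le> n"
      and near: "X i \<omega> + \<zeta> i (real k) \<omega> \<in> cball (g (real k) \<omega>) r"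
    have "0 \<le> t"
      using t of_nat_0_le_iff[of n] by linarith
    with undetected obtain N where
      N: "\<And>i s. s \<in> {0..t + 1 / real (Suc N)} \<Longrightarrow> r < dist (X i \<omega> + \<zeta> i s \<omega>) (g s \<omega>)"
      unfolding detection_time_gt_iff[OF \<open>0 \<le> t\<close>] by blast
    have "0 \<le> 1 / real (Suc N)" "real k \<le> t"
      using \<open>k \<le> n\<close> t by auto
    then have "real k \<in> {0..t + 1 / real (Suc N)}"
      unfolding atLeastAtMost_iff by linarith
    from N[OF this, of i] near show False
      by (simp add: dist_commute)
  qed
  moreover have "?U = {\<omega>\<in>space M. \<forall>i. \<forall>k\<le>n. r < dist (X i \<omega> + \<zeta> i (real k) \<omega>) (g (real k) \<omega>)}"
    by (auto simp: dist_commute not_le)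
  moreover have "\<dots> \<in> events"
    by measurable
  ultimately have "prob {\<omega>\<in>space M. ereal t < detection_time X \<zeta> r g \<omega>} \<le> prob ?U"
    by (intro finite_measure_mono) auto
  also have "\<dots> \<le> ?b"
  proof -
    \<comment> \<open>The avoidance event as a predicate on sample paths; it reads each path at
      finitely many times and is therefore measurable in the product space.\<close>
    define P :: "(real \<Rightarrow> real ^ 2) \<Rightarrow> (nat \<Rightarrow> real ^ 2) \<times> (nat \<Rightarrow> real \<Rightarrow> real ^ 2) \<Rightarrow> bool"
      where "P \<gamma> z \<longleftrightarrow> (\<forall>i. \<forall>k\<le>n. r < dist (fst z i + snd z i (real k)) (\<gamma> (real k)))" for \<gamma> z
    have "emeasure M {\<omega>\<in>space M. P (sample_path g \<omega>) (\<lambda>i. X i \<omega>, \<lambda>i. sample_path (\<zeta> i) \<omega>)} =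
      (\<integral>\<^sup>+\<omega>. emeasure M {\<omega>'\<in>space M. P (sample_path g \<omega>) (\<lambda>i. X i \<omega>', \<lambda>i. sample_path (\<zeta> i) \<omega>')} \<partial>M)"
    proof (rule indep_fubini[OF ind[unfolded independent_of_nodes_def]])
      let ?N = "path_space \<Otimes>\<^sub>M ((\<Pi>\<^sub>M i\<in>UNIV. borel) \<Otimes>\<^sub>M (\<Pi>\<^sub>M i\<in>UNIV. path_space)) ::
        ((real \<Rightarrow> real ^ 2) \<times> (nat \<Rightarrow> real ^ 2) \<times> (nat \<Rightarrow> real \<Rightarrow> real ^ 2)) measure"
      have [measurable]: "(\<lambda>z. snd (snd z) i (real k)) \<in> borel_measurable ?N" "(\<lambda>z. fst z (real k)) \<in> borel_measurable ?N"
          "(\<lambda>z. fst (snd z) i) \<in> borel_measurable ?N" for i k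
        by (intro measurable_compose[OF _ path_space_component] measurable_compose[OF measurable_snd]
            measurable_compose[OF measurable_fst] measurable_component_singleton; simp)+
      show "Measurable.pred ?N (\<lambda>z. P (fst z) (snd z))"
        unfolding P_def by measurable
    qed
    also have "\<dots> \<le> (\<integral>\<^sup>+\<omega>. ennreal ?b \<partial>M)"
    proof (rule nn_integral_mono)
      fix \<omega>
      have "{\<omega>'\<in>space M. P (sample_path g \<omega>) (\<lambda>i. X i \<omega>', \<lambda>i. sample_path (\<zeta> i) \<omega>')} =
          {\<omega>'\<in>space M. \<forall>i. \<forall>k\<le>n. X i \<omega>' + \<zeta> i (real k) \<omega>' \<notin> cball (g (real k) \<omega>) r}"
        by (simp add: P_def sample_path_eq dist_commute not_le)
      then show "emeasure M {\<omega>'\<in>space M. P (sample_path g \<omega>) (\<lambda>i. X i \<omega>', \<lambda>i. sample_path (\<zeta> i) \<omega>')} \<le> ennreal ?b"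
        using fixed by (simp add: emeasure_eq_measure)
    qed
    also have "\<dots> = ennreal ?b"
      by (simp add: emeasure_space_1)
    finally have "ennreal (prob {\<omega>\<in>space M. P (sample_path g \<omega>) (\<lambda>i. X i \<omega>, \<lambda>i. sample_path (\<zeta> i) \<omega>)}) \<le> ennreal ?b"
      by (simp add: emeasure_eq_measure)
    moreover have "?U = {\<omega>\<in>space M. P (sample_path g \<omega>) (\<lambda>i. X i \<omega>, \<lambda>i. sample_path (\<zeta> i) \<omega>)}"
      by (simp add: P_def sample_path_eq dist_commute not_le)
    ultimately show ?thesis
      by simp
  qed
  finally show ?thesis .
qed

end

end

section \<open>Lower bound for a Brownian target\<close>

context prob_space
begin

text \<open>The extra time is \<open>\<theta> * T\<close> and the cut-off time
  \<open>\<rho>\<^sup>2 * l\<close>, both rounded up to the grid. For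
  \<open>\<delta> \<le> 1\<close> the roundings cost at most the \<open>+ 1\<close> in the logarithm
  and, with the additional step of \<open>Suc\<close>, the \<open>+ 2\<close> in the numerator, so
  the bound is free of \<open>\<delta>\<close>.\<close>

lemma plane_hit_le_horizon:
  fixes B :: "real \<Rightarrow> 'a \<Rightarrow> real ^ 2"
  assumes B: "standard_brownian_motion M B"
    and \<delta>: "0 < \<delta>" "\<delta> \<le> 1" "real n * \<delta> = T" and \<rho>: "0 < \<rho>" and l: "0 < l" and \<theta>: "0 \<le> \<theta>"
    and less: "\<rho>\<^sup>2 * l + 1 < \<theta> * T"
  shows "(\<integral>\<^sup>+x. random_walk.hit (gauss_law \<delta>) n (\<lambda>_. ball (0 :: real ^ 2) \<rho>) x \<partial>lborel) \<le>
    ennreal (2 * pi * (T + \<theta> * T + 2) * exp (2 / l) / ln (\<theta> * T / (\<rho>\<^sup>2 * l + 1)))"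
proof -
  define u where "u = nat \<lceil>\<theta> * T / \<delta>\<rceil>"
  define k0 where "k0 = nat \<lceil>\<rho>\<^sup>2 * l / \<delta>\<rceil>"
  have "0 \<le> T"
    using \<delta> by auto
  have \<rho>l: "0 < \<rho>\<^sup>2 * l"
    using \<rho> l by simp
  have "0 \<le> \<theta> * T / \<delta>"
    using \<delta> \<theta> \<open>0 \<le> T\<close> by simp
  then have "\<theta> * T / \<delta> \<le> real u" "real u \<le> \<theta> * T / \<delta> + 1"
    unfolding u_def by linarith+
  then have u: "\<theta> * T \<le> real u * \<delta>" "real u * \<delta> \<le> \<theta> * T + \<delta>"
    using \<delta>(1) by (simp_all add: field_simps)
  have "0 < \<rho>\<^sup>2 * l / \<delta>"
    using \<rho>l \<delta> by simp
  then have k0: "1 \<le> k0" "\<rho>\<^sup>2 * l / \<delta> \<le> real k0" "real k0 \<le> \<rho>\<^sup>2 * l / \<delta> + 1"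
    unfolding k0_def by linarith+
  then have k0': "\<rho>\<^sup>2 * l \<le> real k0 * \<delta>" "real k0 * \<delta> \<le> \<rho>\<^sup>2 * l + 1"
    using \<delta>(1,2) by (simp_all add: field_simps)
  have ratio: "\<theta> * T / (\<rho>\<^sup>2 * l + 1) \<le> real (Suc u) / real k0"
  proof -
    have "\<theta> * T / (\<rho>\<^sup>2 * l + 1) \<le> (real (Suc u) * \<delta>) / (real k0 * \<delta>)"
      using u k0' \<delta> \<rho>l k0(1) less by (intro frac_le) (auto simp: distrib_right)
    then show ?thesis using \<delta>(1) by simp
  qed
  have gt1: "1 < \<theta> * T / (\<rho>\<^sup>2 * l + 1)"
    using less \<rho>l by simp
  have "real k0 * \<delta> < real (Suc u) * \<delta>"
    using u k0' less \<delta>(1) by (simp add: distrib_right)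
  then have "k0 < Suc u"
    using \<delta>(1) by simp
  have "(\<integral>\<^sup>+x. random_walk.hit (gauss_law \<delta>) n (\<lambda>_. ball (0 :: real ^ 2) \<rho>) x \<partial>lborel) \<le>
      ennreal (2 * pi * (real (Suc (n + u)) * \<delta>) * exp (2 / l) / ln (real (Suc u) / real k0))"
    by (rule plane_hit_le[OF B \<delta>(1) \<rho> l k0(1) \<open>k0 < Suc u\<close> k0'(1)])
  also have "\<dots> \<le> ennreal (2 * pi * (T + \<theta> * T + 2) * exp (2 / l) / ln (\<theta> * T / (\<rho>\<^sup>2 * l + 1)))"
  proof (intro ennreal_leI frac_le mult_right_mono mult_left_mono)
    show "real (Suc (n + u)) * \<delta> \<le> T + \<theta> * T + 2"
      using u \<delta> by (simp add: distrib_right)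
    show "ln (\<theta> * T / (\<rho>\<^sup>2 * l + 1)) \<le> ln (real (Suc u) / real k0)"
      using ratio gt1 by (subst ln_le_cancel_iff) auto
    show "0 < ln (\<theta> * T / (\<rho>\<^sup>2 * l + 1))"
      using gt1 by (rule ln_gt_zero)
    show "0 \<le> 2 * pi * (T + \<theta> * T + 2) * exp (2 / l)"
      using \<open>0 \<le> T\<close> \<theta> by simp
  qed auto
  finally show ?thesis .
qed

text \<open>Two coordinates, each decaying at rate \<open>pi\<^sup>2 / (8 * w\<^sup>2)\<close>. The
  error is linear in \<open>\<delta>\<close> at fixed \<open>T\<close> and vanishes along the dyadic
  grids.\<close>

lemma prob_grid_confined:
  fixes B :: "real \<Rightarrow> 'a \<Rightarrow> real ^ 2"
  assumes B: "standard_brownian_motion M B" and w: "0 < w" and \<delta>: "0 < \<delta>" and T: "real n * \<delta> = T"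
  shows "exp (- (pi\<^sup>2 * T / (4 * w\<^sup>2))) - 3 * T * \<delta> / (8 * w ^ 4) \<le>
    prob {\<omega>\<in>space M. \<forall>k\<le>n. B (real k * \<delta>) \<omega> \<in> centred_box w}"
proof -
  let ?E = "{\<omega>\<in>space M. \<exists>k\<le>n. 0 + B (real k * \<delta>) \<omega> \<in> - centred_box w}"
  let ?a = "exp (- (pi\<^sup>2 * T / (4 * w\<^sup>2)))" and ?e = "3 * T * \<delta> / (8 * w ^ 4)"
  have "0 \<le> T" using \<delta> T by auto
  have [measurable]: "B (real k * \<delta>) \<in> borel_measurable M" for k
    using B \<delta> by (simp add: standard_brownian_motion_def continuous_process_def)
  have "emeasure M ?E = random_walk.hit (gauss_law \<delta>) n (\<lambda>_. - centred_box w) (0 :: real ^ 2)"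
    using \<delta> by (intro grid_hit[OF B]) auto
  also have "\<dots> \<le> ennreal (1 - exp (- (DIM(real ^ 2) * (pi / (2 * w))\<^sup>2 * (n * \<delta>) / 2)) +
      n * (DIM(real ^ 2) * (3 * \<delta>\<^sup>2 / (16 * w ^ 4))))"
    by (rule gauss_walk_stay[OF w \<delta>])
  also have "exp (- (DIM(real ^ 2) * (pi / (2 * w))\<^sup>2 * (n * \<delta>) / 2)) = ?a"
    unfolding T using w by (simp add: power_divide power_mult_distrib)
  also have "n * (DIM(real ^ 2) * (3 * \<delta>\<^sup>2 / (16 * w ^ 4))) = ?e"
    unfolding T[symmetric] using w by (simp add: field_simps power2_eq_square)
  finally have "prob ?E \<le> 1 - ?a + ?e"
    using \<open>0 \<le> T\<close> \<delta> by (subst (asm) emeasure_eq_measure, subst (asm) ennreal_le_iff) auto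
  moreover have "prob (space M - ?E) = 1 - prob ?E"
    by (rule prob_compl) measurable
  moreover have "space M - ?E = {\<omega>\<in>space M. \<forall>k\<le>n. B (real k * \<delta>) \<omega> \<in> centred_box w}"
    by auto
  ultimately show ?thesis by simp
qed

text \<open>Confinement of the target and absence of nodes from the disc concern independent inputs,
  so their probabilities multiply on every grid. In the box the target has norm at most
  \<open>2 * w\<close>; the extra \<open>1\<close> in \<open>\<rho>\<close> keeps the distance
  strictly above \<open>r\<close> after the passage to closed sets.\<close>

lemma undetected_ge:
  fixes X :: "nat \<Rightarrow> 'a \<Rightarrow> real ^ 2" and \<zeta> :: "nat \<Rightarrow> real \<Rightarrow> 'a \<Rightarrow> real ^ 2"
    and g :: "real \<Rightarrow> 'a \<Rightarrow> real ^ 2" and lam r :: real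
  assumes lam: "0 \<le> lam" and nodes: "mobile_nodes M lam X \<zeta>"
    and g: "standard_brownian_motion M g" and ind: "independent_of_nodes M X \<zeta> g"
    and t: "0 \<le> t" "T = t + 1" and w: "0 < w" and r: "0 \<le> r" and \<rho>: "\<rho> = r + 2 * w + 1"
    and l: "0 < l" and \<theta>: "0 \<le> \<theta>" and less: "\<rho>\<^sup>2 * l + 1 < \<theta> * T"
  shows "exp (- (lam * (2 * pi * (T + \<theta> * T + 2) * exp (2 / l) / ln (\<theta> * T / (\<rho>\<^sup>2 * l + 1))))) *
      exp (- (pi\<^sup>2 * T / (4 * w\<^sup>2))) \<le>
    prob {\<omega>\<in>space M. ereal t < detection_time X \<zeta> r g \<omega>}"
    (is "exp (- (lam * ?V)) * ?a \<le> _")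
proof -
  have T: "0 < T" using t by simp
  have \<rho>0: "0 < \<rho>" using \<rho> r w by simp
  have gc: "continuous_process M g"
    using g by (simp add: standard_brownian_motion_def)
  define \<delta> where "\<delta> m = T / 2 ^ m" for m :: nat
  have \<delta>: "0 < \<delta> m" "real (2 ^ m) * \<delta> m = T" for m
    using T by (auto simp: \<delta>_def)
  have [measurable]: "g (real k * \<delta> m) \<in> borel_measurable M" "\<zeta> i (real k * \<delta> m) \<in> borel_measurable M" for k m i
    using \<delta>(1)[of m] gc by (auto intro!: motion_measurable[OF nodes] simp: continuous_process_def)
  note node_measurable[OF nodes, measurable]
  have [measurable]: "ball (0 :: real ^ 2) \<rho> \<in> sets borel"
    by simp
  define G where "G m = {\<omega>\<in>space M. \<forall>k\<le>2 ^ m. g (real k * \<delta> m) \<omega> \<in> centred_box w}" for m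
  define A where "A m = {\<omega>\<in>space M. \<forall>i. \<forall>k\<le>2 ^ m. X i \<omega> + \<zeta> i (real k * \<delta> m) \<omega> \<notin> ball 0 \<rho>}" for m
  have events: "G m \<inter> A m \<in> events" for m
    unfolding G_def A_def by measurable
  have G: "?a - 3 * T * \<delta> m / (8 * w ^ 4) \<le> prob (G m)" for m
    unfolding G_def by (rule prob_grid_confined[OF g w \<delta>])
  have A: "exp (- (lam * ?V)) \<le> prob (A m)" if "\<delta> m \<le> 1" for m
  proof -
    interpret W: random_walk "gauss_law (\<delta> m) :: (real ^ 2) measure"
      using \<delta>(1)[of m] by (intro random_walk_gauss_law) simp
    have le: "(\<integral>\<^sup>+x. W.hit (2 ^ m) (\<lambda>_. ball 0 \<rho>) x \<partial>lborel) \<le> ennreal ?V"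
      by (rule plane_hit_le_horizon[OF node_bm[OF nodes] \<delta>(1) that \<delta>(2) \<rho>0 l \<theta> less])
    also have "\<dots> < \<infinity>"
      by simp
    finally obtain v where v: "(\<integral>\<^sup>+x. W.hit (2 ^ m) (\<lambda>_. ball 0 \<rho>) x \<partial>lborel) = ennreal v" "0 \<le> v"
      by (cases "\<integral>\<^sup>+x. W.hit (2 ^ m) (\<lambda>_. ball 0 \<rho>) x \<partial>lborel") auto
    have "0 \<le> \<rho>\<^sup>2 * l"
      using l by simp
    then have "1 < \<theta> * T / (\<rho>\<^sup>2 * l + 1)"
      using less by simp
    then have "0 \<le> ?V"
      using T \<theta> by (intro divide_nonneg_nonneg mult_nonneg_nonneg add_nonneg_nonneg) auto
    then have "v \<le> ?V"
      using le v by simp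
    then have "lam * v \<le> lam * ?V"
      using lam by (rule mult_left_mono)
    then have "exp (- (lam * ?V)) \<le> exp (- (lam * v))"
      by (simp only: exp_le_cancel_iff neg_le_iff_le)
    also have "\<dots> = prob (A m)"
      unfolding A_def using \<delta>(1)[of m] by (intro prob_nodes_avoid[OF nodes lam _ _ v, symmetric]) auto
    finally show ?thesis .
  qed
  have GA: "prob (G m \<inter> A m) = prob (G m) * prob (A m)" for m
  proof -
    define P where "P \<gamma> \<longleftrightarrow> (\<forall>k\<le>2 ^ m. \<gamma> (real k * \<delta> m) \<in> centred_box w)" for \<gamma> :: "real \<Rightarrow> real ^ 2"
    define Q :: "(nat \<Rightarrow> real ^ 2) \<times> (nat \<Rightarrow> real \<Rightarrow> real ^ 2) \<Rightarrow> bool"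
      where "Q z \<longleftrightarrow> (\<forall>i. \<forall>k\<le>2 ^ m. fst z i + snd z i (real k * \<delta> m) \<notin> ball 0 \<rho>)" for z
    have "prob {\<omega>\<in>space M. P (sample_path g \<omega>) \<and> Q (\<lambda>i. X i \<omega>, \<lambda>i. sample_path (\<zeta> i) \<omega>)} =
      prob {\<omega>\<in>space M. P (sample_path g \<omega>)} * prob {\<omega>\<in>space M. Q (\<lambda>i. X i \<omega>, \<lambda>i. sample_path (\<zeta> i) \<omega>)}"
    proof (rule indep_prob[OF ind[unfolded independent_of_nodes_def]])
      have [measurable]: "(\<lambda>p. p (real k * \<delta> m)) \<in> measurable path_space (borel :: (real ^ 2) measure)" for k
        using \<delta>(1)[of m] by (intro path_space_component) simp
      show "Measurable.pred path_space P"
        unfolding P_def by measurable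
      let ?N = "(\<Pi>\<^sub>M i\<in>UNIV. borel) \<Otimes>\<^sub>M (\<Pi>\<^sub>M i\<in>UNIV. path_space) ::
        ((nat \<Rightarrow> real ^ 2) \<times> (nat \<Rightarrow> real \<Rightarrow> real ^ 2)) measure"
      have [measurable]: "(\<lambda>z. snd z i (real k * \<delta> m)) \<in> borel_measurable ?N"
          "(\<lambda>z. fst z i) \<in> borel_measurable ?N" for i k
        using \<delta>(1)[of m]
        by (intro measurable_compose[OF _ path_space_component] measurable_compose[OF measurable_snd]
            measurable_compose[OF measurable_fst] measurable_component_singleton; simp)+
      show "Measurable.pred ?N Q"
        unfolding Q_def by measurable
    qed
    moreover have "sample_path B \<omega> (real k * \<delta> m) = B (real k * \<delta> m) \<omega>"
      for B :: "real \<Rightarrow> 'a \<Rightarrow> real ^ 2" and k \<omega>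
      using \<delta>(1)[of m] by (intro sample_path_eq) simp
    moreover have "G m \<inter> A m = {\<omega>\<in>space M. (\<forall>k\<le>2 ^ m. g (real k * \<delta> m) \<omega> \<in> centred_box w) \<and>
        (\<forall>i. \<forall>k\<le>2 ^ m. X i \<omega> + \<zeta> i (real k * \<delta> m) \<omega> \<notin> ball 0 \<rho>)}"
      by (auto simp: G_def A_def)
    ultimately show ?thesis
      by (simp only: P_def Q_def fst_conv snd_conv G_def A_def)
  qed
  define D where "D = (\<Inter>m. G m \<inter> A m)"
  have "(\<lambda>m. prob (G m \<inter> A m)) \<longlonglongrightarrow> prob D"
    unfolding D_def
  proof (rule finite_Lim_measure_decseq)
    show "range (\<lambda>m. G m \<inter> A m) \<subseteq> events"
      using events by auto
    show "decseq (\<lambda>m. G m \<inter> A m)"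
    proof (rule decseq_SucI)
      fix m
      \<comment> \<open>Dyadic grids are nested, which makes the events decreasing in
        \<open>m\<close>.\<close>
      have refine: "real k * \<delta> m = real (2 * k) * \<delta> (Suc m)" "2 * k \<le> 2 ^ Suc m" if "k \<le> 2 ^ m" for k
        using that by (auto simp: \<delta>_def)
      have "G (Suc m) \<subseteq> G m"
        unfolding G_def using refine by (intro subsetI) (simp only: mem_Collect_eq, metis)
      moreover have "A (Suc m) \<subseteq> A m"
        unfolding A_def using refine by (intro subsetI) (simp only: mem_Collect_eq, metis)
      ultimately show "G (Suc m) \<inter> A (Suc m) \<subseteq> G m \<inter> A m"
        by (rule Int_mono)
    qed
  qed
  moreover have "(\<lambda>m. exp (- (lam * ?V)) * (?a - 3 * T * \<delta> m / (8 * w ^ 4))) \<longlonglongrightarrow>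
      exp (- (lam * ?V)) * (?a - 3 * T * 0 / (8 * w ^ 4))"
    and \<delta>_lim: "\<delta> \<longlonglongrightarrow> 0"
  proof -
    show "\<delta> \<longlonglongrightarrow> 0"
      unfolding \<delta>_def[abs_def] using tendsto_mult_right_zero[OF LIMSEQ_power_zero[of "1 / 2 :: real"], of T]
      by (simp add: power_divide)
    then show "(\<lambda>m. exp (- (lam * ?V)) * (?a - 3 * T * \<delta> m / (8 * w ^ 4))) \<longlonglongrightarrow>
      exp (- (lam * ?V)) * (?a - 3 * T * 0 / (8 * w ^ 4))"
      using w by (intro tendsto_intros) auto
  qed
  \<comment> \<open>The node estimate requires \<open>\<delta> m \<le> 1\<close>, so the comparison
    is available only for large \<open>m\<close>.\<close>
  moreover have "\<forall>\<^sub>F m in sequentially. exp (- (lam * ?V)) * (?a - 3 * T * \<delta> m / (8 * w ^ 4)) \<le> prob (G m \<inter> A m)"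
    using order_tendstoD(2)[OF \<delta>_lim zero_less_one]
  proof eventually_elim
    case (elim m)
    have "exp (- (lam * ?V)) * (?a - 3 * T * \<delta> m / (8 * w ^ 4)) \<le> exp (- (lam * ?V)) * prob (G m)"
      by (intro mult_left_mono G) simp
    also have "\<dots> \<le> prob (A m) * prob (G m)"
      using elim by (intro mult_right_mono A) auto
    finally show ?case
      by (simp only: GA mult.commute)
  qed
  ultimately have "exp (- (lam * ?V)) * (?a - 3 * T * 0 / (8 * w ^ 4)) \<le> prob D"
    by (intro tendsto_le[OF sequentially_bot])
  then have "exp (- (lam * ?V)) * ?a \<le> prob D"
    by simp
  also have "\<dots> \<le> prob {\<omega>\<in>space M. ereal t < detection_time X \<zeta> r g \<omega>}"
  proof (rule finite_measure_mono)
    show "{\<omega>\<in>space M. ereal t < detection_time X \<zeta> r g \<omega>} \<in> events"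
      by (rule detection_event[OF nodes gc t(1)])
    show "D \<subseteq> {\<omega>\<in>space M. ereal t < detection_time X \<zeta> r g \<omega>}"
    proof
      fix \<omega> assume "\<omega> \<in> D"
      then have \<omega>: "\<omega> \<in> space M"
          and gD: "\<And>m k. k \<le> 2 ^ m \<Longrightarrow> g (real k * (T / 2 ^ m)) \<omega> \<in> centred_box w"
          and AD: "\<And>m k i. k \<le> 2 ^ m \<Longrightarrow> X i \<omega> + \<zeta> i (real k * (T / 2 ^ m)) \<omega> \<notin> ball 0 \<rho>"
        by (auto simp: D_def G_def A_def \<delta>_def)
      have "r < dist (X i \<omega> + \<zeta> i s \<omega>) (g s \<omega>)" if s: "s \<in> {0..T}" for i s
      proof -
        have c: "continuous_on {0..} (\<lambda>s. g s \<omega>)" "continuous_on {0..} (\<lambda>s. \<zeta> i s \<omega>)"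
          using gc node_bm[OF nodes, of i] \<omega>
          by (auto simp: continuous_process_def standard_brownian_motion_def)
        have g_cont: "continuous_on {0..T} (\<lambda>s. g s \<omega>)"
          by (rule continuous_on_subset[OF c(1)]) auto
        have node_cont: "continuous_on {0..T} (\<lambda>s. X i \<omega> + \<zeta> i s \<omega>)"
          by (intro continuous_on_add continuous_on_const continuous_on_subset[OF c(2)]) auto
        have "g s \<omega> \<in> {y. \<forall>b\<in>Basis. \<bar>y \<bullet> b\<bar> \<le> w}"
        proof (rule continuous_on_dyadic_closed[OF g_cont _ T _ s])
          show "closed {y :: real ^ 2. \<forall>b\<in>Basis. \<bar>y \<bullet> b\<bar> \<le> w}"
          proof -
            have "{y :: real ^ 2. \<forall>b\<in>Basis. \<bar>y \<bullet> b\<bar> \<le> w} = (\<Inter>b\<in>Basis. {y. \<bar>y \<bullet> b\<bar> \<le> w})"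
              by auto
            also have "closed \<dots>"
              by (intro closed_INT ballI closed_Collect_le continuous_intros)
            finally show ?thesis .
          qed
          show "g (real k * (T / 2 ^ m)) \<omega> \<in> {y. \<forall>b\<in>Basis. \<bar>y \<bullet> b\<bar> \<le> w}" if "k \<le> 2 ^ m" for m k
            using gD[OF that] by (auto simp: centred_box_def intro: less_imp_le)
        qed
        then have "(\<Sum>b\<in>Basis. \<bar>g s \<omega> \<bullet> b\<bar>) \<le> (\<Sum>b\<in>(Basis :: (real ^ 2) set). w)"
          by (intro sum_mono) auto
        then have "norm (g s \<omega>) \<le> 2 * w"
          using norm_le_l1[of "g s \<omega>"] by simp
        moreover have "X i \<omega> + \<zeta> i s \<omega> \<in> - ball 0 \<rho>"
        proof (rule continuous_on_dyadic_closed[OF node_cont _ T _ s])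
          show "closed (- ball (0 :: real ^ 2) \<rho>)"
            by (simp add: closed_Compl)
          show "X i \<omega> + \<zeta> i (real k * (T / 2 ^ m)) \<omega> \<in> - ball 0 \<rho>" if "k \<le> 2 ^ m" for m k
            using AD[OF that] by simp
        qed
        then have "\<rho> \<le> norm (X i \<omega> + \<zeta> i s \<omega>)"
          unfolding Compl_iff mem_ball_0 by simp
        moreover have "norm (X i \<omega> + \<zeta> i s \<omega>) \<le> norm (X i \<omega> + \<zeta> i s \<omega> - g s \<omega>) + norm (g s \<omega>)"
          by (rule norm_triangle_sub[of "X i \<omega> + \<zeta> i s \<omega>" "g s \<omega>", THEN order_trans]) simp
        ultimately show ?thesis
          using \<rho> unfolding dist_norm by linarith
      qed
      \<comment> \<open>The margin for \<open>N = 0\<close> is exactly \<open>1\<close>; this is the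
        reason for \<open>T = t + 1\<close>.\<close>
      then show "\<omega> \<in> {\<omega>\<in>space M. ereal t < detection_time X \<zeta> r g \<omega>}"
        using \<omega> t(2) by (auto simp: detection_time_gt_iff[OF t(1)] intro!: exI[of _ 0])
    qed
  qed
  finally show ?thesis .
qed

end

section \<open>Asymptotics in \<open>t\<close>\<close>

lemma harm_le_ln: "1 \<le> n \<Longrightarrow> harm n \<le> 1 + ln (real n)"
  \<comment> \<open>The sequence \<open>harm n - ln n\<close> decreases from the value
    \<open>1\<close> at \<open>n = 1\<close>.\<close>
  using euler_mascheroni_sequence_decreasing[of 1 n] by (simp add: harm_expand)

theorem theorem1p1:
  fixes M :: "'w measure" and lam r :: real
    and X :: "nat \<Rightarrow> 'w \<Rightarrow> real ^ 2"
    and \<zeta> :: "nat \<Rightarrow> real \<Rightarrow> 'w \<Rightarrow> real ^ 2"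
    and g :: "real \<Rightarrow> 'w \<Rightarrow> real ^ 2"
  assumes "prob_space M"
    and "lam > 0" and "r > 0"
    and "mobile_nodes M lam X \<zeta>"
    and "continuous_process M g"
    and "\<forall>\<omega>\<in>space M. g 0 \<omega> = 0"
    and "independent_of_nodes M X \<zeta> g"
  shows "(\<exists>h \<in> o[at_top](\<lambda>_. 1 :: real). \<forall>\<^sub>F t in at_top.
            measure M {\<omega>\<in>space M. detection_time X \<zeta> r g \<omega> > ereal t}
              \<le> exp (- 2 * pi * lam * (t / ln t) * (1 + h t)))
       \<and> (standard_brownian_motion M g \<longrightarrow>
          (\<exists>h \<in> o[at_top](\<lambda>_. 1 :: real). \<forall>\<^sub>F t in at_top.
            measure M {\<omega>\<in>space M. detection_time X \<zeta> r g \<omega> > ereal t}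
              = exp (- 2 * pi * lam * (t / ln t) * (1 + h t))))"
proof -
  interpret prob_space M by fact
  let ?P = "\<lambda>t. prob {\<omega>\<in>space M. detection_time X \<zeta> r g \<omega> > ereal t}"
  \<comment> \<open>Solves \<open>pi * r\<^sup>2 * t / (1 + r\<^sup>2 / 2 * (1 + ln t)) = 2 * pi *
    (t / ln t) * (1 + h\<^sub>1 t)\<close> for \<open>t > 1\<close>.\<close>
  define h\<^sub>1 where "h\<^sub>1 t = r\<^sup>2 * ln t / (2 + r\<^sup>2 + r\<^sup>2 * ln t) - 1" for t
  have small: "f \<in> o[at_top](\<lambda>_. 1)" if "(f \<longlongrightarrow> 0) at_top" for f :: "real \<Rightarrow> real"
    using that by (intro smalloI_tendsto) auto
  have h\<^sub>1: "(h\<^sub>1 \<longlongrightarrow> 0) at_top"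
    unfolding h\<^sub>1_def using \<open>0 < r\<close> by real_asymp
  have upper: "?P t \<le> exp (- 2 * pi * lam * (t / ln t) * (1 + h\<^sub>1 t))" if t: "1 < t" for t
  proof -
    define n where "n = nat \<lfloor>t\<rfloor>"
    have n: "real n \<le> t" "t \<le> real (Suc n)" "1 \<le> n"
      using t unfolding n_def by (linarith+)
    have "ln (real n) \<le> ln t"
      using n by (subst ln_le_cancel_iff) auto
    with harm_le_ln[OF n(3)] have "harm n \<le> 1 + ln t"
      by linarith
    then have "pi * r\<^sup>2 * t / (1 + r\<^sup>2 / 2 * (1 + ln t)) \<le> pi * r\<^sup>2 * real (Suc n) / (1 + r\<^sup>2 / 2 * harm n)"
      using n t by (intro frac_le add_left_mono mult_left_mono add_pos_nonneg mult_nonneg_nonneg harm_nonneg) auto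
    moreover have "pi * r\<^sup>2 * t / (1 + r\<^sup>2 / 2 * (1 + ln t)) = 2 * pi * (t / ln t) * (1 + h\<^sub>1 t)"
    proof -
      have "1 + r\<^sup>2 / 2 * (1 + ln t) = (2 + r\<^sup>2 + r\<^sup>2 * ln t) / 2"
        by (simp add: field_simps)
      then have "pi * r\<^sup>2 * t / (1 + r\<^sup>2 / 2 * (1 + ln t)) = pi * r\<^sup>2 * t / ((2 + r\<^sup>2 + r\<^sup>2 * ln t) / 2)"
        by (simp only:)
      also have "\<dots> = 2 * pi * (t / ln t) * (1 + h\<^sub>1 t)"
        using ln_gt_zero[OF t] by (simp add: h\<^sub>1_def)
      finally show ?thesis .
    qed
    ultimately have "lam * (2 * pi * (t / ln t) * (1 + h\<^sub>1 t)) \<le>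
        lam * (pi * r\<^sup>2 * real (Suc n) / (1 + r\<^sup>2 / 2 * harm n))"
      using \<open>lam > 0\<close> by (simp only:) (rule mult_left_mono; simp)
    then have "exp (- (lam * (pi * r\<^sup>2 * real (Suc n) / (1 + r\<^sup>2 / 2 * harm n)))) \<le>
        exp (- 2 * pi * lam * (t / ln t) * (1 + h\<^sub>1 t))"
      by (simp only: exp_le_cancel_iff) (simp add: mult_ac)
    moreover have "?P t \<le> exp (- (lam * (pi * r\<^sup>2 * real (Suc n) / (1 + r\<^sup>2 / 2 * harm n))))"
      using assms(2,3) by (intro undetected_le[OF assms(4,5) _ assms(7) _ n(1)]) simp_all
    ultimately show ?thesis
      by (rule order_trans[rotated])
  qed
  have "\<exists>h\<in>o[at_top](\<lambda>_. 1). \<forall>\<^sub>F t in at_top. ?P t = exp (- 2 * pi * lam * (t / ln t) * (1 + h t))"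
    if bm: "standard_brownian_motion M g"
  proof -
    \<comment> \<open>The scales are \<open>w = l = ln t\<close> and
      \<open>\<theta> = 1 / ln t\<close>. Then \<open>exp (2 / l)\<close> and
      \<open>1 + \<theta>\<close> tend to \<open>1\<close>, and since
      \<open>\<rho>\<^sup>2 * l\<close> is of order \<open>(ln t) ^ 3\<close>, the denominator is
      \<open>ln t\<close> up to a multiple of \<open>ln (ln t)\<close>.\<close>
    define V where "V t = 2 * pi * ((t + 1) + 1 / ln t * (t + 1) + 2) * exp (2 / ln t) /
      ln (1 / ln t * (t + 1) / ((r + 2 * ln t + 1)\<^sup>2 * ln t + 1))" for t
    \<comment> \<open>Defined by solving the claimed equation. This is legitimate where
      \<open>?P t\<close> is positive, which the lower bound guarantees for large
      \<open>t\<close>.\<close>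
    define h where "h t = - ln (?P t) * ln t / (2 * pi * lam * t) - 1" for t
    \<comment> \<open>The same normalisation applied to the exponent of the lower bound; the
      confinement term contributes only order \<open>1 / ln t\<close>.\<close>
    define h\<^sub>2 where "h\<^sub>2 t = (lam * V t + pi\<^sup>2 * (t + 1) / (4 * (ln t)\<^sup>2)) * ln t / (2 * pi * lam * t) - 1" for t
    have h\<^sub>2: "(h\<^sub>2 \<longlongrightarrow> 0) at_top"
      unfolding h\<^sub>2_def V_def using \<open>0 < r\<close> \<open>0 < lam\<close> by real_asymp (simp add: field_simps)
    have "\<forall>\<^sub>F t in at_top. (r + 2 * ln t + 1)\<^sup>2 * ln t + 1 < 1 / ln t * (t + 1)"
      using \<open>0 < r\<close> by real_asymp
    then have lower: "\<forall>\<^sub>F t in at_top. exp (- (lam * V t + pi\<^sup>2 * (t + 1) / (4 * (ln t)\<^sup>2))) \<le> ?P t"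
      using eventually_gt_at_top[of 1]
    proof eventually_elim
      case (elim t)
      have "exp (- (lam * V t)) * exp (- (pi\<^sup>2 * (t + 1) / (4 * (ln t)\<^sup>2))) \<le> ?P t"
        unfolding V_def
        using elim assms(2,3) ln_gt_zero[of t]
        by (intro undetected_ge[OF _ assms(4) bm assms(7)]) auto
      then show ?case
        by (simp add: exp_add[symmetric])
    qed
    have h_eq: "\<forall>\<^sub>F t in at_top. ?P t = exp (- 2 * pi * lam * (t / ln t) * (1 + h t))"
      using lower eventually_gt_at_top[of 1]
    proof eventually_elim
      case (elim t)
      have "0 < ?P t"
        using elim(1) by (rule less_le_trans[OF exp_gt_zero])
      moreover have "- 2 * pi * lam * (t / ln t) * (1 + h t) = ln (?P t)"
        using elim(2) ln_gt_zero[of t] \<open>0 < lam\<close> by (simp add: h_def)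
      ultimately show ?case
        by simp
    qed
    have "(h \<longlongrightarrow> 0) at_top"
    proof (rule tendsto_sandwich[OF _ _ h\<^sub>1 h\<^sub>2])
      show "\<forall>\<^sub>F t in at_top. h\<^sub>1 t \<le> h t"
        using h_eq eventually_gt_at_top[of 1]
      proof eventually_elim
        case (elim t)
        have "exp (- 2 * pi * lam * (t / ln t) * (1 + h t)) \<le> exp (- 2 * pi * lam * (t / ln t) * (1 + h\<^sub>1 t))"
          using upper[OF elim(2)] unfolding elim(1) .
        then have "2 * pi * lam * (t / ln t) * (1 + h\<^sub>1 t) \<le> 2 * pi * lam * (t / ln t) * (1 + h t)"
          by simp
        moreover have "0 < 2 * pi * lam * (t / ln t)"
          using elim(2) ln_gt_zero[of t] \<open>0 < lam\<close> by simp
        ultimately have "1 + h\<^sub>1 t \<le> 1 + h t"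
          by (rule mult_left_le_imp_le)
        then show ?case by simp
      qed
      show "\<forall>\<^sub>F t in at_top. h t \<le> h\<^sub>2 t"
        using lower eventually_gt_at_top[of 1]
      proof eventually_elim
        case (elim t)
        have "0 < ?P t"
          using elim(1) by (rule less_le_trans[OF exp_gt_zero])
        with elim(1) have "- (lam * V t + pi\<^sup>2 * (t + 1) / (4 * (ln t)\<^sup>2)) \<le> ln (?P t)"
          by (subst ln_ge_iff) auto
        then have "- ln (?P t) * ln t / (2 * pi * lam * t) \<le>
            (lam * V t + pi\<^sup>2 * (t + 1) / (4 * (ln t)\<^sup>2)) * ln t / (2 * pi * lam * t)"
          using elim(2) \<open>0 < lam\<close> by (intro divide_right_mono mult_right_mono) auto
        then show ?case
          by (simp add: h_def h\<^sub>2_def)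
      qed
    qed
    then show ?thesis
      using h_eq small by blast
  qed
  moreover have "\<forall>\<^sub>F t in at_top. ?P t \<le> exp (- 2 * pi * lam * (t / ln t) * (1 + h\<^sub>1 t))"
    using eventually_gt_at_top[of 1] by eventually_elim (rule upper)
  ultimately show ?thesis
    using small[OF h\<^sub>1] by blast
qed

end
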